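(* Let $G$ be a locally compact group with a fixed Haar measure and let $\Gamma\subset G$ be a lattice. Let $K\subset G$ be a compact subgroup and assume that on $X=G/K$ there is given a $G$-invariant proper metric $d$ (inducing the topology of $X$). For $T>0$ let $b(T)$ denote the Haar measure of the closed ball $\overline B_T$ of radius $T$ around $eK$ in $X$, i.e. the Haar measure of $\{g\in G: d(gK,eK)\le T\}$, and let $$N(T)=\#\{\gamma\in\Gamma: d(\gamma K,eK)\le T\}.$$ Assume that (a) $G$ acts $K$-mixingly on $\Gamma\backslash G$, and (b) the function $b$ is regular. Then, as $T\to\infty$, $$N(T)\ \sim\ \frac{1}{\mathrm{vol}(\Gamma\backslash G)}\,b(T).$$
   Context: A lattice $\Gamma\subset G$ is a discrete subgroup such that $\Gamma\backslash G$ carries a $G$-invariant Radon measure of finite volume; the measure on $\Gamma\backslash G$ is the quotient of the fixed Haar measure on $G$ by counting measure on $\Gamma$, and $\mathrm{vol}(\Gamma\backslash G)$ is taken with respect to it. A metric is proper if closed balls are compact. Let $L^2_0(\Gamma\backslash G)=\{f\in L^2(\Gamma\backslash G):\int_{\Gamma\backslash G}f(x)\,dx=0\}$, on which $G$ acts unitarily by right translation. A matrix coefficient of a unitary representation $(\pi,V)$ of $G$ is a function $\psi_{v,w}(x)=\langle\pi(x)v,w\rangle$ with $v,w\in V$; it is called $K$-invariant if $\psi(kx)=\psi(xk)=\psi(x)$ for all $x\in G$, $k\in K$. One says that $G$ acts $K$-mixingly on $\Gamma\backslash G$ if every $K$-invariant matrix coefficient of $L^2_0(\Gamma\backslash G)$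 vanishes at infinity on $G$. A monotonically increasing function $b:[0,\infty)\to[0,\infty)$ with $\lim_{T\to\infty}b(T)=\infty$ is called regular if $$\lim_{\varepsilon\searrow0}\liminf_{T\to\infty}\frac{b(T-\varepsilon)}{b(T)}=\lim_{\varepsilon\searrow0}\limsup_{T\to\infty}\frac{b(T+\varepsilon)}{b(T)}$$ (in which case both limits equal $1$). The notation $f\sim g$ means $f(T)/g(T)\to1$. *)

theory Defs
  imports "HOL-Analysis.Analysis"
begin

text \<open>
  The group $G$ is a type of class \<^class>\<open>topological_group_add\<close>. The library writes topological
  groups additively, but the class does not assume commutativity: $gh$ is rendered \<open>g + h\<close>,
  $g^{-1}$ is \<open>- g\<close> and the neutral element $e$ is \<open>0\<close>.
\<close>

subsection \<open>Subgroups, cosets and coset spaces\<close>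

definition is_subgroup :: "'g::group_add set \<Rightarrow> bool" where
  "is_subgroup H \<longleftrightarrow> 0 \<in> H \<and> (\<forall>x\<in>H. \<forall>y\<in>H. x + y \<in> H) \<and> (\<forall>x\<in>H. - x \<in> H)"

text \<open>For sets \<open>A\<close> that are themselves cosets, these maps are the left action of $G$ on $G/K$ and the
  right action of $G$ on $\Gamma\backslash G$.\<close>

definition ltrans :: "'g::group_add \<Rightarrow> 'g set \<Rightarrow> 'g set" where
  "ltrans g A = (\<lambda>x. g + x) ` A"

definition rtrans :: "'g::group_add set \<Rightarrow> 'g \<Rightarrow> 'g set" where
  "rtrans A g = (\<lambda>x. x + g) ` A"

definition quotient_topology :: "('g::topological_space \<Rightarrow> 'b) \<Rightarrow> 'b topology" where
  "quotient_topology p = topology (\<lambda>U. U \<subseteq> range p \<and> open (p -` U))"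

lemma openin_quotient_topology:
  "openin (quotient_topology p) U \<longleftrightarrow> U \<subseteq> range p \<and> open (p -` U)"
proof -
  have "istopology (\<lambda>U. U \<subseteq> range p \<and> open (p -` U))"
    unfolding istopology_def by (auto simp: vimage_Union)
  then show ?thesis
    unfolding quotient_topology_def by (simp add: topology_inverse')
qed

lemma topspace_quotient_topology: "topspace (quotient_topology p) = range p"
proof
  show "topspace (quotient_topology p) \<subseteq> range p"
    by (auto simp: topspace_def openin_quotient_topology)
  have "p -` range p = UNIV"
    by auto
  then have "openin (quotient_topology p) (range p)"
    by (simp add: openin_quotient_topology)
  then show "range p \<subseteq> topspace (quotient_topology p)"
    by (rule openin_subset)
qed

lemma quotient_map_quotient_topology: "quotient_map euclidean (quotient_topology p) p"
  by (auto simp: quotient_map_def openin_quotient_topology topspace_quotient_topology vimage_def)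

text \<open>The space $G/K$ of left cosets $gK$ and the space $\Gamma\backslash G$ of right cosets $\Gamma g$.\<close>

definition left_coset_space :: "'g::{topological_space,group_add} set \<Rightarrow> 'g set topology" where
  "left_coset_space K = quotient_topology (\<lambda>g. ltrans g K)"

definition right_coset_space :: "'g::{topological_space,group_add} set \<Rightarrow> 'g set topology" where
  "right_coset_space \<Gamma> = quotient_topology (\<lambda>g. rtrans \<Gamma> g)"

subsection \<open>Radon, Haar and quotient measures\<close>

definition radon_measure :: "'a topology \<Rightarrow> 'a measure \<Rightarrow> bool" where
  "radon_measure X M \<longleftrightarrow>
     sets M = sets (sigma (topspace X) {U. openin X U}) \<and>
     (\<forall>C. compactin X C \<longrightarrow> emeasure M C < \<infinity>) \<and>
     (\<forall>A\<in>sets M. emeasure M A = (INF U\<in>{U. openin X U \<and> A \<subseteq> U}. emeasure M U)) \<and>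
     (\<forall>U. openin X U \<longrightarrow> emeasure M U = (SUP C\<in>{C. compactin X C \<and> C \<subseteq> U}. emeasure M C))"

definition haar_measure :: "'g::topological_group_add measure \<Rightarrow> bool" where
  "haar_measure \<mu> \<longleftrightarrow>
     radon_measure euclidean \<mu> \<and>
     emeasure \<mu> (space \<mu>) \<noteq> 0 \<and>
     (\<forall>g. \<forall>A\<in>sets \<mu>. emeasure \<mu> (ltrans g A) = emeasure \<mu> A)"

definition finite_invariant_measure ::
    "'g::topological_group_add set \<Rightarrow> 'g set measure \<Rightarrow> bool" where
  "finite_invariant_measure \<Gamma> \<nu> \<longleftrightarrow>
     radon_measure (right_coset_space \<Gamma>) \<nu> \<and>
     emeasure \<nu> (space \<nu>) \<noteq> 0 \<and> emeasure \<nu> (space \<nu>) < \<infinity> \<and>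
     (\<forall>g. \<forall>A\<in>sets \<nu>. emeasure \<nu> ((\<lambda>c. rtrans c g) ` A) = emeasure \<nu> A)"

definition lattice_subgroup :: "'g::topological_group_add set \<Rightarrow> bool" where
  "lattice_subgroup \<Gamma> \<longleftrightarrow>
     is_subgroup \<Gamma> \<and> discrete \<Gamma> \<and> (\<exists>\<nu>. finite_invariant_measure \<Gamma> \<nu>)"

text \<open>
  The invariant measure on $\Gamma\backslash G$ is determined up to a positive scalar; the quotient of
  \<open>\<mu>\<close> by counting measure on \<open>\<Gamma>\<close> is the one normalised by the quotient integral formula
  $\int_G f\,d\mu = \int_{\Gamma\backslash G} \sum_{\gamma\in\Gamma} f(\gamma x)\,d\nu(\Gamma x)$ for
  $f \in C_c(G)$. The inner sum only depends on the coset $c = \Gamma x$: it is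
  $\sum_{y\in c} f(y)$.
\<close>

definition quotient_measure ::
    "'g::topological_group_add measure \<Rightarrow> 'g set \<Rightarrow> 'g set measure \<Rightarrow> bool" where
  "quotient_measure \<mu> \<Gamma> \<nu> \<longleftrightarrow>
     finite_invariant_measure \<Gamma> \<nu> \<and>
     (\<forall>f :: 'g \<Rightarrow> real.
        continuous_on UNIV f \<and> (\<exists>C. compact C \<and> (\<forall>x. x \<notin> C \<longrightarrow> f x = 0)) \<longrightarrow>
        (\<integral>x. f x \<partial>\<mu>) = (\<integral>c. (\<Sum>\<^sub>\<infinity>y\<in>c. f y) \<partial>\<nu>))"

subsection \<open>The representation on $L^2_0(\Gamma\backslash G)$ and mixing\<close>

text \<open>Elements of $L^2_0$ are given by representatives; the matrix coefficients below do not depend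
  on the choice of representatives.\<close>

definition L20 :: "'a measure \<Rightarrow> ('a \<Rightarrow> complex) set" where
  "L20 \<nu> = {f \<in> borel_measurable \<nu>. integrable \<nu> (\<lambda>c. (cmod (f c))\<^sup>2) \<and> (\<integral>c. f c \<partial>\<nu>) = 0}"

definition L2_inner :: "'a measure \<Rightarrow> ('a \<Rightarrow> complex) \<Rightarrow> ('a \<Rightarrow> complex) \<Rightarrow> complex" where
  "L2_inner \<nu> v w = (\<integral>c. v c * cnj (w c) \<partial>\<nu>)"

definition right_translation :: "'g::group_add \<Rightarrow> ('g set \<Rightarrow> complex) \<Rightarrow> 'g set \<Rightarrow> complex" where
  "right_translation g v = (\<lambda>c. v (rtrans c g))"

definition matrix_coefficient ::
    "'g::group_add set measure \<Rightarrow> ('g set \<Rightarrow> complex) \<Rightarrow> ('g set \<Rightarrow> complex) \<Rightarrow> 'g \<Rightarrow> complex" where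
  "matrix_coefficient \<nu> v w x = L2_inner \<nu> (right_translation x v) w"

definition K_invariant :: "'g::group_add set \<Rightarrow> ('g \<Rightarrow> complex) \<Rightarrow> bool" where
  "K_invariant K \<psi> \<longleftrightarrow> (\<forall>x. \<forall>k\<in>K. \<psi> (k + x) = \<psi> x \<and> \<psi> (x + k) = \<psi> x)"

definition vanishes_at_infinity :: "('g::topological_space \<Rightarrow> complex) \<Rightarrow> bool" where
  "vanishes_at_infinity \<psi> \<longleftrightarrow> (\<forall>\<epsilon>>0. \<exists>C. compact C \<and> (\<forall>x. x \<notin> C \<longrightarrow> cmod (\<psi> x) < \<epsilon>))"

definition acts_K_mixingly ::
    "'g::topological_group_add set \<Rightarrow> 'g set measure \<Rightarrow> bool" where
  "acts_K_mixingly K \<nu> \<longleftrightarrow>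
     (\<forall>v\<in>L20 \<nu>. \<forall>w\<in>L20 \<nu>.
        K_invariant K (matrix_coefficient \<nu> v w) \<longrightarrow>
        vanishes_at_infinity (matrix_coefficient \<nu> v w))"

subsection \<open>The metric on $G/K$\<close>

definition invariant_proper_metric ::
    "'g::topological_group_add set \<Rightarrow> ('g set \<Rightarrow> 'g set \<Rightarrow> real) \<Rightarrow> bool" where
  "invariant_proper_metric K d \<longleftrightarrow>
     Metric_space (topspace (left_coset_space K)) d \<and>
     Metric_space.mtopology (topspace (left_coset_space K)) d = left_coset_space K \<and>
     (\<forall>A\<in>topspace (left_coset_space K). \<forall>r.
        compactin (left_coset_space K) (Metric_space.mcball (topspace (left_coset_space K)) d A r)) \<and>
     (\<forall>g. \<forall>A\<in>topspace (left_coset_space K). \<forall>B\<in>topspace (left_coset_space K).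
        d (ltrans g A) (ltrans g B) = d A B)"

definition ball_volume ::
    "'g::group_add measure \<Rightarrow> 'g set \<Rightarrow> ('g set \<Rightarrow> 'g set \<Rightarrow> real) \<Rightarrow> real \<Rightarrow> real" where
  "ball_volume \<mu> K d T = measure \<mu> {g. d (ltrans g K) (ltrans 0 K) \<le> T}"

definition lattice_count ::
    "'g::group_add set \<Rightarrow> 'g set \<Rightarrow> ('g set \<Rightarrow> 'g set \<Rightarrow> real) \<Rightarrow> real \<Rightarrow> nat" where
  "lattice_count \<Gamma> K d T = card {\<gamma>\<in>\<Gamma>. d (ltrans \<gamma> K) (ltrans 0 K) \<le> T}"

subsection \<open>Regular growth functions\<close>

text \<open>Only the values on $[0,\infty)$ matter. The limits are taken in the extended reals, where they
  always exist by monotonicity in \<open>\<epsilon>\<close>; regularity says that they coincide.\<close>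

definition regular_growth :: "(real \<Rightarrow> real) \<Rightarrow> bool" where
  "regular_growth b \<longleftrightarrow>
     (\<forall>T\<ge>0. b T \<ge> 0) \<and> mono_on {0..} b \<and> filterlim b at_top at_top \<and>
     (\<exists>L::ereal.
        ((\<lambda>\<epsilon>. Liminf at_top (\<lambda>T. ereal (b (T - \<epsilon>) / b T))) \<longlongrightarrow> L) (at_right 0) \<and>
        ((\<lambda>\<epsilon>. Limsup at_top (\<lambda>T. ereal (b (T + \<epsilon>) / b T))) \<longlongrightarrow> L) (at_right 0))"

end

theory Submission
  imports Defs
begin

text \<open>
  All geometry enters through the function \<open>len g = d (gK) (eK)\<close>. Invariance of the metric makes it
  symmetric, subadditive and zero on \<open>K\<close>, and properness of the metric together with compactness of
  \<open>K\<close> makes its balls compact in the group (\<open>proper_length_of_invariant_metric\<close>).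

  The count \<open>N T\<close> is the sum over \<open>\<gamma>\<close> of the indicator of \<open>len \<gamma> \<le> T\<close>. Let \<open>h\<close> be a function of
  \<open>len\<close> with integral one, supported where \<open>len < \<epsilon>\<close>. Replacing \<open>\<gamma>\<close> by \<open>- x + \<gamma> + y\<close> and averaging
  against \<open>h x * h y\<close> moves lengths by at most \<open>2 * \<epsilon>\<close>, so the averaged count lies between
  \<open>N (T - 2 * \<epsilon>)\<close> and \<open>N (T + 2 * \<epsilon>)\<close>. On the other hand, the substitution \<open>z = - x + \<gamma> + y\<close> and
  unfolding over the lattice turn it into the integral over the ball \<open>len z \<le> T\<close> of
  \<open>\<langle>\<pi>(z) \<theta>, \<theta>\<rangle>\<close>, where \<open>\<theta> (\<Gamma>x)\<close> is the sum of \<open>h (\<gamma> + x)\<close> over \<open>\<gamma>\<close>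
  (\<open>sum_smoothed_eq_integral\<close>).

  As \<open>\<theta>\<close> has integral one, it is the constant \<open>1 / vol\<close> plus an element of $L^2_0$ that is
  invariant under \<open>K\<close>. Mixing therefore gives \<open>\<langle>\<pi>(z) \<theta>, \<theta>\<rangle> = 1 / vol + o(1)\<close>
  (\<open>correlation_limit\<close>), and integrating over the ball gives \<open>b T / vol + o(b T)\<close>
  (\<open>lattice_count_bounds\<close>). Regularity of \<open>b\<close> absorbs the shift of the radius by \<open>2 * \<epsilon>\<close>
  (\<open>asymp_equiv_of_regular_squeeze\<close>).

  The group is \<open>\<sigma>\<close>-compact but need not be second countable, so a continuous function on its square
  need not be measurable for the product of the Borel \<open>\<sigma>\<close>-algebras. Exchanging the integrals is
  possible because all integrands are built from \<open>len\<close>, for which measurability does hold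
  (\<open>measurable_len_product\<close>).
\<close>

section \<open>Length functions on a topological group\<close>

text \<open>
  A continuous length function with compact balls. It may vanish away from \<open>0\<close>: the length attached to a
  metric on \<open>G/K\<close> is zero exactly on \<open>K\<close>.
\<close>
locale proper_length =
  fixes len :: "'g::{topological_group_add,t2_space} \<Rightarrow> real"
  assumes len_zero [simp]: "len 0 = 0"
    and len_minus [simp]: "len (- x) = len x"
    and len_add: "len (x + y) \<le> len x + len y"
    and open_len_less: "open {x. len x < r}"
    and compact_len_le: "compact {x. len x \<le> r}"
begin

lemma len_nonneg [simp]: "len x \<ge> 0"
  using len_add[of x "- x"] by simp

lemma len_add_ge: "len x - len y \<le> len (x + y)" and len_add_ge': "- len x + len y \<le> len (x + y)"
  using len_add[of "x + y" "- y"] len_add[of "- x" "x + y"]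
  by (simp_all add: add.assoc flip: add.assoc[of "-x"])

lemma len_add_eq:
  assumes "len k = 0"
  shows "len (k + x) = len x" "len (x + k) = len x"
  using len_add[of k x] len_add[of x k] len_add_ge[of k x] len_add_ge[of x k] len_add_ge'[of k x] len_add_ge'[of x k] assms by auto

lemma continuous_len: "continuous_on UNIV len"
  unfolding continuous_on_topological
proof clarsimp
  fix x B assume "open B" "len x \<in> B"
  then obtain e where "e > 0" and e: "\<And>y. dist y (len x) < e \<Longrightarrow> y \<in> B"
    unfolding open_dist by blast
  let ?A = "(\<lambda>y. - x + y) -` {z. len z < e}"
  have "open ?A"
    using open_len_less by (intro open_vimage continuous_intros)
  moreover have "x \<in> ?A" using \<open>e > 0\<close> by simp
  moreover have "len y \<in> B" if "y \<in> ?A" for y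
  proof (rule e)
    show "dist (len y) (len x) < e"
      using that len_add_ge[of "- x" y] len_add_ge'[of "- x" y] by (auto simp: dist_real_def)
  qed
  ultimately show "\<exists>A. open A \<and> x \<in> A \<and> (\<forall>y. y \<in> A \<longrightarrow> len y \<in> B)" by blast
qed

lemma continuous_on_len [continuous_intros]:
  "continuous_on S f \<Longrightarrow> continuous_on S (\<lambda>x. len (f x))"
  by (rule continuous_on_compose2[OF continuous_len]) auto

text \<open>
  Balls of integer radius are compact, so finitely many translates of any small ball cover each of them.
  The group itself may fail to be separable; density is meant for the pseudometric
  \<open>len (- x + y)\<close>.
\<close>
lemma countable_dense:
  obtains D where "countable D" "\<And>x e. e > 0 \<Longrightarrow> \<exists>q\<in>D. len (- q + x) < e"
proof -
  have "\<exists>F. finite F \<and> {x. len x \<le> real n} \<subseteq> (\<Union>q\<in>F. (\<lambda>x. - q + x) -` {z. len z < 1 / Suc m})" for n m :: nat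
  proof (rule compactE_image[OF compact_len_le])
    show "{x. len x \<le> real n} \<subseteq> (\<Union>q\<in>UNIV. (\<lambda>x. - q + x) -` {z. len z < 1 / Suc m})"
    proof
      fix x show "x \<in> (\<Union>q\<in>UNIV. (\<lambda>x. - q + x) -` {z. len z < 1 / Suc m})"
        by (rule UN_I[of x]) auto
    qed
    show "open ((\<lambda>x. - q + x) -` {z. len z < 1 / Suc m})" for q
      using open_len_less by (intro open_vimage continuous_intros)
  qed blast
  then obtain F where fin: "\<And>n m. finite (F n m)"
    and F: "\<And>n m. {x. len x \<le> real n} \<subseteq> (\<Union>q\<in>F n m. (\<lambda>x. - q + x) -` {z. len z < 1 / Suc m})"
    by metis
  show thesis
  proof (rule that)
    show "countable (\<Union>n m. F n m)"
      using fin by (intro countable_UN) (auto intro: countable_finite)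
    fix x and e :: real assume "e > 0"
    obtain m where m: "1 / Suc m < e" using nat_approx_posE[OF \<open>e > 0\<close>] by blast
    obtain n where "len x \<le> real n" using real_arch_simple by blast
    with F[of n m] obtain q where "q \<in> F n m" "len (- q + x) < 1 / Suc m" by auto
    with m show "\<exists>q\<in>\<Union>n m. F n m. len (- q + x) < e" by (auto intro: less_trans)
  qed
qed

text \<open>
  By the triangle inequality through a point \<open>q\<close>, the set where \<open>len (a + x + z) < c\<close> is the union,
  over \<open>q\<close> in a countable dense set and rational \<open>r\<close>, of the rectangles
  \<open>len (a + x + q) < r\<close>, \<open>len (- q + z) < c - r\<close>. This makes Tonelli's theorem applicable on a group
  whose topology may have no countable base.
\<close>
lemma measurable_len_product:
  "(\<lambda>(x, z). len (a + x + z)) \<in> borel_measurable (borel \<Otimes>\<^sub>M borel)"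
proof -
  obtain D where D: "countable D" "\<And>x e. e > 0 \<Longrightarrow> \<exists>q\<in>D. len (- q + x) < e"
    using countable_dense by blast
  let ?R = "\<lambda>c q r. {x. len (a + x + q) < r} \<times> {z. len (- q + z) < c - r}"
  have R: "?R c q r \<in> sets (borel \<Otimes>\<^sub>M borel)" for c q r
  proof (intro pair_measureI borel_open)
    have "open ((\<lambda>x. a + x + q) -` {z. len z < r})"
      using open_len_less by (intro open_vimage continuous_intros)
    then show "open {x. len (a + x + q) < r}" by (simp add: vimage_def)
    have "open ((\<lambda>x. - q + x) -` {z. len z < c - r})"
      using open_len_less by (intro open_vimage continuous_intros)
    then show "open {z. len (- q + z) < c - r}" by (simp add: vimage_def)
  qed
  have "{w \<in> space (borel \<Otimes>\<^sub>M borel). (case w of (x, z) \<Rightarrow> len (a + x + z)) < c}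
      = (\<Union>q\<in>D. \<Union>r\<in>\<rat>. ?R c q r)" for c
  proof (intro set_eqI iffI)
    fix w assume "w \<in> (\<Union>q\<in>D. \<Union>r\<in>\<rat>. ?R c q r)"
    then obtain q r where "w \<in> ?R c q r" by blast
    then obtain x z where w: "w = (x, z)" "len (a + x + q) < r" "len (- q + z) < c - r" by auto
    have "len (a + x + z) = len ((a + x + q) + (- q + z))" by (simp add: add.assoc flip: add.assoc[of q])
    also have "\<dots> < c" using len_add[of "a + x + q" "- q + z"] w by linarith
    finally show "w \<in> {w \<in> space (borel \<Otimes>\<^sub>M borel). (case w of (x, z) \<Rightarrow> len (a + x + z)) < c}"
      using w by (simp add: space_pair_measure)
  next
    fix w assume "w \<in> {w \<in> space (borel \<Otimes>\<^sub>M borel). (case w of (x, z) \<Rightarrow> len (a + x + z)) < c}"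
    then obtain x z where w: "w = (x, z)" "len (a + x + z) < c" by (cases w) auto
    define e where "e = (c - len (a + x + z)) / 2"
    have "e > 0" using w by (simp add: e_def)
    then obtain q where q: "q \<in> D" "len (- q + z) < e" using D by blast
    have "len (a + x + q) = len ((a + x + z) + - (- q + z))"
      by (simp add: minus_add add.assoc)
    also have "\<dots> \<le> len (a + x + z) + len (- q + z)" by (metis len_add len_minus)
    also have "\<dots> < len (a + x + z) + e" using q by simp
    also have "\<dots> = c - e" by (simp add: e_def field_simps)
    finally have less: "len (a + x + q) < c - e" .
    have "len (a + x + q) < c - len (- q + z)" using less q by linarith
    then obtain r where r: "r \<in> \<rat>" "len (a + x + q) < r" "r < c - len (- q + z)"
      using Rats_dense_in_real by blast
    then have "w \<in> ?R c q r" using w by simp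
    then show "w \<in> (\<Union>q\<in>D. \<Union>r\<in>\<rat>. ?R c q r)" using q r by blast
  qed
  moreover have "(\<Union>q\<in>D. \<Union>r\<in>\<rat>. ?R c q r) \<in> sets (borel \<Otimes>\<^sub>M borel)" for c
    using D(1) R by (intro sets.countable_UN'') (auto simp: countable_rat)
  ultimately show ?thesis
    unfolding borel_measurable_iff_less by simp
qed

end

section \<open>The length function of an invariant metric\<close>

lemma compact_sums_group:
  fixes S T :: "'g::topological_group_add set"
  assumes "compact S" "compact T"
  shows "compact ((\<lambda>(x, y). x + y) ` (S \<times> T))"
proof (rule compact_continuous_image)
  show "continuous_on (S \<times> T) (\<lambda>(x, y). x + y)"
    unfolding case_prod_unfold by (intro continuous_intros)
qed (use assms in \<open>rule compact_Times\<close>)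

lemma ltrans_ltrans: "ltrans g (ltrans h A) = ltrans (g + h) A"
  by (auto simp: ltrans_def image_image add.assoc)

lemma ltrans_zero [simp]: "ltrans 0 A = A"
  by (simp add: ltrans_def)

lemma rtrans_rtrans: "rtrans (rtrans A g) h = rtrans A (g + h)"
  by (auto simp: rtrans_def image_image add.assoc)

lemma rtrans_zero [simp]: "rtrans A 0 = A"
  by (simp add: rtrans_def)

lemma ltrans_subgroup:
  assumes "is_subgroup K" "k \<in> K"
  shows "ltrans k K = K"
proof
  show "ltrans k K \<subseteq> K" using assms by (auto simp: ltrans_def is_subgroup_def)
  show "K \<subseteq> ltrans k K"
  proof
    fix x assume "x \<in> K"
    then have "- k + x \<in> K" using assms by (simp add: is_subgroup_def)
    then show "x \<in> ltrans k K"
      unfolding ltrans_def by (rule rev_image_eqI) (simp flip: add.assoc)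
  qed
qed

lemma rtrans_subgroup:
  assumes "is_subgroup H" "k \<in> H"
  shows "rtrans H k = H"
proof
  show "rtrans H k \<subseteq> H" using assms by (auto simp: rtrans_def is_subgroup_def)
  show "H \<subseteq> rtrans H k"
  proof
    fix x assume "x \<in> H"
    then have "x + - k \<in> H" using assms unfolding is_subgroup_def by blast
    then show "x \<in> rtrans H k"
      unfolding rtrans_def by (rule rev_image_eqI) (simp add: add.assoc)
  qed
qed

text \<open>
  Everything except compactness of balls is read off from the invariant metric. A ball in the group is
  the preimage of a compact ball in the coset space. That ball is covered by finitely many images of
  translates \<open>g + U\<close>, where \<open>U\<close> has compact closure, so the preimage is a closed subset of finitely many
  compact sets \<open>g + N + K\<close>.
\<close>
lemma proper_length_of_invariant_metric:
  fixes K :: "'g::{topological_group_add,t2_space} set"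
  assumes lc: "locally_compact_space (euclidean :: 'g topology)"
    and K: "is_subgroup K" "compact K"
    and d: "invariant_proper_metric K d"
  shows "proper_length (\<lambda>g. d (ltrans g K) (ltrans 0 K))"
proof -
  let ?X = "topspace (left_coset_space K)" and ?p = "\<lambda>g. ltrans g K"
  let ?len = "\<lambda>g. d (?p g) (?p 0)"
  have X: "?X = range ?p"
    by (simp add: left_coset_space_def topspace_quotient_topology)
  have openin_X: "openin (left_coset_space K) U \<longleftrightarrow> U \<subseteq> range ?p \<and> open (?p -` U)" for U
    by (simp add: left_coset_space_def openin_quotient_topology)
  have pX [simp]: "?p g \<in> ?X" for g by (simp add: X)
  interpret Metric_space ?X d using d by (simp add: invariant_proper_metric_def)
  have top: "mtopology = left_coset_space K"
    and inv: "\<And>g h k. d (?p (g + h)) (?p (g + k)) = d (?p h) (?p k)"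
    using d by (auto simp: invariant_proper_metric_def simp flip: ltrans_ltrans)
  have cball: "compactin (left_coset_space K) (mcball (?p 0) r)" for r
    using d pX[of 0] unfolding invariant_proper_metric_def by blast
  have open_lt: "open {g. ?len g < r}" for r
  proof -
    have "openin (left_coset_space K) (mball (?p 0) r)"
      using openin_mball[of "?p 0" r] by (simp only: top)
    then have "open (?p -` mball (?p 0) r)" by (simp add: openin_X)
    moreover have "?p -` mball (?p 0) r = {g. ?len g < r}"
      using pX by (auto simp: mball_def commute[of "?p 0"] simp del: ltrans_zero)
    ultimately show ?thesis by simp
  qed
  have len_add: "?len (x + y) \<le> ?len x + ?len y" for x y
  proof -
    have "?len (x + y) \<le> d (?p (x + y)) (?p x) + ?len x"
      by (intro triangle pX)
    also have "d (?p (x + y)) (?p x) = ?len y"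
      using inv[of x y 0] by simp
    finally show ?thesis by simp
  qed
  have len_minus: "?len (- x) = ?len x" for x
    using inv[of x "- x" 0] commute[of "?p 0" "?p x"] by simp
  show ?thesis
  proof
    show "?len 0 = 0" using zero[OF pX[of 0] pX[of 0]] by simp
    show "?len (- x) = ?len x" for x by (rule len_minus)
    show "?len (x + y) \<le> ?len x + ?len y" for x y by (rule len_add)
    show "open {x. ?len x < r}" for r by (rule open_lt)
    fix r
    obtain U N :: "'g set" where U: "open U" "compact N" "0 \<in> U" "U \<subseteq> N"
      using lc unfolding locally_compact_space_def by (fastforce dest: spec[of _ 0])
    let ?V = "\<lambda>g. ?p ` ltrans g U"
    \<comment> \<open>The preimage is \<open>g + U + K\<close>, written so that it is visibly open.\<close>
    have V_preimage: "?p -` ?V g = (\<Union>k\<in>K. (\<lambda>x. - g + (x + k)) -` U)" for g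
    proof (intro set_eqI iffI)
      fix x assume "x \<in> ?p -` ?V g"
      then obtain u where u: "u \<in> U" "?p x = ?p (g + u)" by (auto simp: ltrans_def)
      have "g + u \<in> ?p x"
        using K(1) unfolding u(2) is_subgroup_def by (force simp: ltrans_def)
      then obtain k where k: "k \<in> K" "g + u = x + k" by (auto simp: ltrans_def)
      have "- g + (x + k) = u" by (simp flip: k(2))
      then show "x \<in> (\<Union>k\<in>K. (\<lambda>x. - g + (x + k)) -` U)" using k u by auto
    next
      fix x assume "x \<in> (\<Union>k\<in>K. (\<lambda>x. - g + (x + k)) -` U)"
      then obtain k where k: "k \<in> K" "- g + (x + k) \<in> U" by auto
      have "?p x = ?p (x + k)"
        using ltrans_subgroup[OF K(1) k(1)] by (simp flip: ltrans_ltrans)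
      moreover have "x + k \<in> ltrans g U"
        unfolding ltrans_def by (rule rev_image_eqI[OF k(2)]) (simp flip: add.assoc)
      ultimately show "x \<in> ?p -` ?V g" by auto
    qed
    have "openin (left_coset_space K) (?V g)" for g
      unfolding openin_X V_preimage
      using U by (auto intro!: open_UN open_vimage continuous_intros)
    moreover have "mcball (?p 0) r \<subseteq> \<Union> (range ?V)"
    proof
      fix c assume "c \<in> mcball (?p 0) r"
      then have "c \<in> ?X" by (simp add: mcball_def)
      then obtain g where c: "c = ?p g" unfolding X by blast
      have "g \<in> ltrans g U" using U unfolding ltrans_def by (intro rev_image_eqI[of 0]) auto
      then show "c \<in> \<Union> (range ?V)" using c by blast
    qed
    ultimately obtain \<F> where \<F>: "finite \<F>" "\<F> \<subseteq> range ?V" "mcball (?p 0) r \<subseteq> \<Union> \<F>"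
      using compactinD[OF cball[of r], of "range ?V"] by blast
    then obtain F where F: "finite F" "\<F> = ?V ` F" by (meson finite_subset_image)
    \<comment> \<open>\<open>- k\<close> instead of \<open>k\<close>, because the form of the preimage above gives \<open>x + k \<in> g + U\<close>.\<close>
    let ?C = "\<Union>g\<in>F. (\<lambda>x. g + x) ` ((\<lambda>(x, y). x + y) ` (N \<times> uminus ` K))"
    have "compact ?C"
      using F U K
      by (intro compact_UN compact_continuous_image compact_sums_group continuous_intros) auto
    moreover have "{x. ?len x \<le> r} \<subseteq> ?C"
    proof
      fix x assume "x \<in> {x. ?len x \<le> r}"
      then have "?p x \<in> mcball (?p 0) r" using commute by (simp add: mcball_def del: ltrans_zero)
      then obtain g where "g \<in> F" "?p x \<in> ?V g" using \<F>(3) unfolding F(2) by blast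
      then have "x \<in> ?p -` ?V g" by simp
      then obtain k where "k \<in> K" "- g + (x + k) \<in> U" unfolding V_preimage by auto
      moreover from this have "- g + (x + k) \<in> N" using U by blast
      moreover have "x = g + ((- g + (x + k)) + - k)"
      proof -
        have "g + ((- g + (x + k)) + - k) = (g + - g) + (x + (k + - k))"
          by (simp only: add.assoc)
        then show ?thesis by (simp only: add.right_inverse add_0 add_0_right)
      qed
      ultimately show "x \<in> ?C"
        using \<open>g \<in> F\<close> by (intro UN_I[of g] rev_image_eqI[of "(- g + (x + k)) + - k"]
            rev_image_eqI[of "(- g + (x + k), - k)"]) auto
    qed
    moreover have "closed {x. ?len x \<le> r}"
    proof -
      have "openin (left_coset_space K) (?X - mcball (?p 0) r)"
        using closedin_mcball[of "?p 0" r] unfolding top closedin_def by blast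
      then have "open (?p -` (?X - mcball (?p 0) r))" unfolding openin_X by blast
      moreover have "?p -` (?X - mcball (?p 0) r) = - {x. ?len x \<le> r}"
        using pX by (auto simp: mcball_def commute[of "?p 0"] simp del: ltrans_zero)
      ultimately have "open (- {x. ?len x \<le> r})" by (simp only:)
      then show ?thesis by (simp add: closed_def)
    qed
    ultimately have "compact (?C \<inter> {x. ?len x \<le> r})" by (intro compact_Int_closed)
    then show "compact {x. ?len x \<le> r}"
      using \<open>{x. ?len x \<le> r} \<subseteq> ?C\<close> by (simp add: Int_absorb1)
  qed
qed

section \<open>Haar measure, the lattice and the quotient\<close>

text \<open>
  On a coset \<open>\<Gamma>x\<close> this is the sum of \<open>f (\<gamma> + x)\<close> over the lattice; taking the coset itself as the
  argument makes it a function on the quotient without any choice of representative, in the form used by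
  the quotient integral formula.
\<close>
definition periodization :: "('g \<Rightarrow> real) \<Rightarrow> 'g set \<Rightarrow> real" where
  "periodization f c = (\<Sum>\<^sub>\<infinity>y\<in>c. f y)"

locale lattice_with_length = proper_length len
  for len :: "'g::{topological_group_add,t2_space} \<Rightarrow> real" +
  fixes \<mu> :: "'g measure" and \<Gamma> :: "'g set" and \<nu> :: "'g set measure"
  assumes haar: "haar_measure \<mu>"
    and lattice: "lattice_subgroup \<Gamma>"
    and quotient: "quotient_measure \<mu> \<Gamma> \<nu>"
begin

lemma sets_haar [measurable_cong]: "sets \<mu> = sets borel"
  using haar by (simp add: haar_measure_def radon_measure_def borel_def sets_measure_of_conv)

lemma space_haar [simp]: "space \<mu> = UNIV"
  using sets_eq_imp_space_eq[OF sets_haar] by simp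

lemma emeasure_compact_finite: "compact C \<Longrightarrow> emeasure \<mu> C < \<infinity>"
  using haar by (simp add: haar_measure_def radon_measure_def)

lemma ball_in_sets: "{x. len x \<le> r} \<in> sets \<mu>" "{x. len x < r} \<in> sets \<mu>"
  using compact_imp_closed[OF compact_len_le] open_len_less by (simp_all add: sets_haar)

lemma emeasure_ball_finite: "emeasure \<mu> {x. len x \<le> r} \<noteq> \<infinity>"
  using emeasure_compact_finite[OF compact_len_le, of r] by simp

lemma sigma_finite_haar: "sigma_finite_measure \<mu>"
proof
  show "\<exists>A. countable A \<and> A \<subseteq> sets \<mu> \<and> \<Union>A = space \<mu> \<and> (\<forall>a\<in>A. emeasure \<mu> a \<noteq> \<infinity>)"
  proof (intro exI conjI)
    let ?A = "range (\<lambda>n::nat. {x. len x \<le> real n})"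
    show "countable ?A" "?A \<subseteq> sets \<mu>" "\<forall>a\<in>?A. emeasure \<mu> a \<noteq> \<infinity>"
      using ball_in_sets emeasure_ball_finite by auto
    show "\<Union>?A = space \<mu>"
      using real_arch_simple by auto
  qed
qed

lemma measurable_left_translation: "(\<lambda>x. a + x) \<in> borel \<rightarrow>\<^sub>M borel"
  for a :: 'g
  by (intro borel_measurable_continuous_onI continuous_intros)

lemma distr_left_translation: "distr \<mu> \<mu> (\<lambda>x. a + x) = \<mu>"
proof (rule measure_eqI)
  fix A assume "A \<in> sets (distr \<mu> \<mu> (\<lambda>x. a + x))"
  then have A: "A \<in> sets \<mu>" by simp
  have "(\<lambda>x. a + x) -` A = ltrans (- a) A"
    by (force simp: ltrans_def simp flip: add.assoc)
  moreover have "emeasure \<mu> (ltrans (- a) A) = emeasure \<mu> A"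
    using haar A by (simp add: haar_measure_def)
  ultimately show "emeasure (distr \<mu> \<mu> (\<lambda>x. a + x)) A = emeasure \<mu> A"
    using A measurable_left_translation[of a]
    by (subst emeasure_distr) (auto simp: measurable_cong_sets[OF sets_haar sets_haar])
qed simp

lemma nn_integral_left_translation:
  assumes "f \<in> borel_measurable borel"
  shows "(\<integral>\<^sup>+x. f (a + x) \<partial>\<mu>) = (\<integral>\<^sup>+x. f x \<partial>\<mu>)"
proof -
  have "(\<integral>\<^sup>+x. f x \<partial>distr \<mu> \<mu> (\<lambda>x. a + x)) = (\<integral>\<^sup>+x. f (a + x) \<partial>\<mu>)"
    using assms measurable_left_translation[of a]
    by (intro nn_integral_distr)
       (auto simp: measurable_cong_sets[OF sets_haar sets_haar] measurable_cong_sets[OF sets_haar refl])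
  then show ?thesis by (simp add: distr_left_translation)
qed

text \<open>
  Countably many translates of a ball cover the group, so a null ball would make Haar measure zero.
\<close>
lemma emeasure_ball_pos:
  assumes "r > 0"
  shows "emeasure \<mu> {x. len x < r} \<noteq> 0"
proof
  assume zero: "emeasure \<mu> {x. len x < r} = 0"
  obtain D where D: "countable D" "\<And>x. \<exists>q\<in>D. len (- q + x) < r"
    using countable_dense \<open>r > 0\<close> by metis
  have "ltrans q {x. len x < r} \<in> null_sets \<mu>" for q
  proof (rule null_setsI)
    show "emeasure \<mu> (ltrans q {x. len x < r}) = 0"
      using haar zero ball_in_sets by (simp add: haar_measure_def)
    have "ltrans q {x. len x < r} = (\<lambda>x. - q + x) -` {x. len x < r}"
      by (force simp: ltrans_def simp flip: add.assoc)
    moreover have "open ((\<lambda>x. - q + x) -` {x. len x < r})"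
      using open_len_less by (intro open_vimage continuous_intros)
    ultimately show "ltrans q {x. len x < r} \<in> sets \<mu>"
      by (simp add: sets_haar)
  qed
  then have "(\<Union>q\<in>D. ltrans q {x. len x < r}) \<in> null_sets \<mu>"
    using D(1) by (intro null_sets_UN') auto
  moreover have "(\<Union>q\<in>D. ltrans q {x. len x < r}) = UNIV"
  proof (intro set_eqI iffI UNIV_I)
    fix x
    obtain q where "q \<in> D" "len (- q + x) < r" using D by blast
    then show "x \<in> (\<Union>q\<in>D. ltrans q {x. len x < r})"
      by (intro UN_I[of q]) (auto simp: ltrans_def simp flip: add.assoc intro!: rev_image_eqI[of "- q + x"])
  qed
  ultimately have "emeasure \<mu> (space \<mu>) = 0" by auto
  then show False using haar by (simp add: haar_measure_def)
qed

lemma integrable_compact_support: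
  fixes f :: "'g \<Rightarrow> real"
  assumes "continuous_on UNIV f" "\<And>x. len x \<ge> r \<Longrightarrow> f x = 0"
  shows "integrable \<mu> f"
proof -
  have "compact (f ` {x. len x \<le> r})"
    using assms compact_len_le by (intro compact_continuous_image) (auto intro: continuous_on_subset)
  then obtain B where B: "\<And>x. len x \<le> r \<Longrightarrow> \<bar>f x\<bar> \<le> B"
    using compact_imp_bounded[of "f ` {x. len x \<le> r}"] unfolding bounded_iff by auto
  show ?thesis
  proof (rule integrableI_bounded_set)
    show "{x. len x \<le> r} \<in> sets \<mu>" by (rule ball_in_sets)
    show "f \<in> borel_measurable \<mu>"
      using borel_measurable_continuous_onI[OF assms(1)] measurable_cong_sets[OF sets_haar refl] by blast
    show "emeasure \<mu> {x. len x \<le> r} < \<infinity>"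
      using compact_len_le by (rule emeasure_compact_finite)
    show "AE x in \<mu>. x \<in> {x. len x \<le> r} \<longrightarrow> norm (f x) \<le> B" using B by simp
    show "AE x in \<mu>. x \<notin> {x. len x \<le> r} \<longrightarrow> f x = 0" using assms(2) by auto
  qed
qed

lemma subgroup: "is_subgroup \<Gamma>"
  using lattice by (simp add: lattice_subgroup_def)

text \<open>
  Discreteness at \<open>0\<close> gives a neighbourhood \<open>V\<close> of \<open>0\<close> such that no translate of \<open>V\<close> contains two
  lattice points; finitely many translates cover the compact ball.
\<close>
lemma finite_lattice_ball: "finite {\<gamma>\<in>\<Gamma>. len \<gamma> \<le> r}"
proof -
  have "0 \<in> \<Gamma>" using subgroup by (simp add: is_subgroup_def)
  then obtain W where W: "open W" "W \<inter> \<Gamma> = {0}"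
    using lattice by (auto simp: lattice_subgroup_def discrete_def isolated_in_def)
  have "open ((\<lambda>p::'g \<times> 'g. - fst p + snd p) -` W)"
    using W(1) by (intro open_vimage continuous_intros)
  moreover have "(0, 0) \<in> (\<lambda>p::'g \<times> 'g. - fst p + snd p) -` W"
    using W by auto
  ultimately obtain V1 V2 where V: "open V1" "open V2" "(0, 0) \<in> V1 \<times> V2"
      "V1 \<times> V2 \<subseteq> (\<lambda>p::'g \<times> 'g. - fst p + snd p) -` W"
    by (rule open_prod_elim)
  define V where "V = V1 \<inter> V2"
  have V: "open V" "0 \<in> V" "\<And>x y. x \<in> V \<Longrightarrow> y \<in> V \<Longrightarrow> - x + y \<in> W"
    using V by (auto simp: V_def)
  obtain F where F: "finite F" "{x. len x \<le> r} \<subseteq> (\<Union>x\<in>F. (\<lambda>y. - x + y) -` V)"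
  proof (rule compactE_image[OF compact_len_le])
    show "open ((\<lambda>y. - x + y) -` V)" for x
      using V by (intro open_vimage continuous_intros)
    show "{x. len x \<le> r} \<subseteq> (\<Union>x\<in>UNIV. (\<lambda>y. - x + y) -` V)"
    proof
      fix x show "x \<in> (\<Union>x\<in>UNIV. (\<lambda>y. - x + y) -` V)"
        using V by (intro UN_I[of x]) auto
    qed
  qed blast
  have "finite (\<Gamma> \<inter> (\<lambda>y. - x + y) -` V)" for x
  proof -
    have eq: "\<gamma> = \<gamma>'" if \<gamma>: "\<gamma> \<in> \<Gamma> \<inter> (\<lambda>y. - x + y) -` V" "\<gamma>' \<in> \<Gamma> \<inter> (\<lambda>y. - x + y) -` V" for \<gamma> \<gamma>'
    proof -
      have "- (- x + \<gamma>) + (- x + \<gamma>') \<in> W" using V(3) \<gamma> by simp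
      also have "- (- x + \<gamma>) + (- x + \<gamma>') = - \<gamma> + \<gamma>'"
        by (simp add: minus_add add.assoc)
      finally have "- \<gamma> + \<gamma>' \<in> W \<inter> \<Gamma>"
        using \<gamma> subgroup by (simp add: is_subgroup_def)
      then show ?thesis using W(2) by (metis add.assoc add.right_inverse add_0 add_0_right singletonD)
    qed
    show ?thesis
    proof (cases "\<Gamma> \<inter> (\<lambda>y. - x + y) -` V = {}")
      case False
      then obtain \<gamma> where "\<gamma> \<in> \<Gamma> \<inter> (\<lambda>y. - x + y) -` V" by blast
      then have "\<Gamma> \<inter> (\<lambda>y. - x + y) -` V \<subseteq> {\<gamma>}" using eq by blast
      then show ?thesis by (rule finite_subset) simp
    qed simp
  qed
  then have "finite (\<Union>x\<in>F. \<Gamma> \<inter> (\<lambda>y. - x + y) -` V)" using F(1) by blast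
  moreover have "{\<gamma>\<in>\<Gamma>. len \<gamma> \<le> r} \<subseteq> (\<Union>x\<in>F. \<Gamma> \<inter> (\<lambda>y. - x + y) -` V)" using F(2) by blast
  ultimately show ?thesis by (rule rev_finite_subset)
qed

lemma finite_invariant: "finite_invariant_measure \<Gamma> \<nu>"
  using quotient by (simp add: quotient_measure_def)

lemma topspace_cosets: "topspace (right_coset_space \<Gamma>) = range (rtrans \<Gamma>)"
  by (simp add: right_coset_space_def topspace_quotient_topology)

lemma sets_quotient:
  "sets \<nu> = sigma_sets (range (rtrans \<Gamma>)) {U. openin (right_coset_space \<Gamma>) U}"
proof -
  have "{U. openin (right_coset_space \<Gamma>) U} \<subseteq> Pow (range (rtrans \<Gamma>))"
    using openin_subset topspace_cosets by blast
  then show ?thesis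
    using finite_invariant
    by (simp add: finite_invariant_measure_def radon_measure_def topspace_cosets sets_measure_of_conv)
qed

lemma openin_cosets:
  "openin (right_coset_space \<Gamma>) U \<longleftrightarrow> U \<subseteq> range (rtrans \<Gamma>) \<and> open (rtrans \<Gamma> -` U)"
  by (simp add: right_coset_space_def openin_quotient_topology)

lemma space_quotient: "space \<nu> = range (rtrans \<Gamma>)"
proof -
  have "sets \<nu> = sets (sigma (range (rtrans \<Gamma>)) {U. openin (right_coset_space \<Gamma>) U})"
    using finite_invariant
    by (simp add: finite_invariant_measure_def radon_measure_def topspace_cosets)
  then have "space \<nu> = space (sigma (range (rtrans \<Gamma>)) {U. openin (right_coset_space \<Gamma>) U})"
    by (rule sets_eq_imp_space_eq)
  then show ?thesis by (simp add: space_measure_of_conv)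
qed

lemma rtrans_in_space: "c \<in> space \<nu> \<Longrightarrow> rtrans c g \<in> space \<nu>"
  by (auto simp: space_quotient rtrans_rtrans)

lemma finite_measure_quotient: "finite_measure \<nu>"
  using finite_invariant by (intro finite_measureI) (auto simp: finite_invariant_measure_def)

lemma vol_pos: "measure \<nu> (space \<nu>) > 0"
  using finite_invariant finite_measure_quotient
  by (simp add: finite_invariant_measure_def measure_def enn2real_positive_iff top.not_eq_extremum
      zero_less_iff_neq_zero)

text \<open>
  The quotient carries the final topology of the projection, so continuity can be tested on the group.
\<close>
lemma borel_measurable_quotientI:
  fixes F :: "'g set \<Rightarrow> real"
  assumes "continuous_on UNIV (\<lambda>x. F (rtrans \<Gamma> x))"
  shows "F \<in> borel_measurable \<nu>"
proof (rule borel_measurableI)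
  fix S :: "real set" assume "open S"
  then have "open ((\<lambda>x. F (rtrans \<Gamma> x)) -` S)"
    using assms by (rule open_vimage)
  also have "(\<lambda>x. F (rtrans \<Gamma> x)) -` S = rtrans \<Gamma> -` (F -` S \<inter> space \<nu>)"
    by (auto simp: space_quotient)
  finally have "openin (right_coset_space \<Gamma>) (F -` S \<inter> space \<nu>)"
    by (simp add: openin_cosets) (simp add: space_quotient)
  then show "F -` S \<inter> space \<nu> \<in> sets \<nu>"
    unfolding sets_quotient by (intro sigma_sets.Basic) simp
qed

lemma measurable_right_translation: "(\<lambda>c. rtrans c g) \<in> \<nu> \<rightarrow>\<^sub>M \<nu>"
proof (rule measurable_sigma_sets[OF sets_quotient])
  show "{U. openin (right_coset_space \<Gamma>) U} \<subseteq> Pow (range (rtrans \<Gamma>))"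
    by (auto simp: openin_cosets)
  show "(\<lambda>c. rtrans c g) \<in> space \<nu> \<rightarrow> range (rtrans \<Gamma>)"
    using rtrans_in_space by (simp add: space_quotient)
  fix U assume "U \<in> {U. openin (right_coset_space \<Gamma>) U}"
  then have "open ((\<lambda>x. x + g) -` (rtrans \<Gamma> -` U))"
    by (intro open_vimage continuous_intros) (simp add: openin_cosets)
  also have "(\<lambda>x. x + g) -` (rtrans \<Gamma> -` U) = rtrans \<Gamma> -` ((\<lambda>c. rtrans c g) -` U \<inter> space \<nu>)"
    by (auto simp: space_quotient rtrans_rtrans)
  finally have "openin (right_coset_space \<Gamma>) ((\<lambda>c. rtrans c g) -` U \<inter> space \<nu>)"
    by (simp add: openin_cosets) (simp add: space_quotient)
  then show "(\<lambda>c. rtrans c g) -` U \<inter> space \<nu> \<in> sets \<nu>"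
    unfolding sets_quotient by (intro sigma_sets.Basic) simp
qed

lemma distr_right_translation: "distr \<nu> \<nu> (\<lambda>c. rtrans c g) = \<nu>"
proof (rule measure_eqI)
  fix A assume "A \<in> sets (distr \<nu> \<nu> (\<lambda>c. rtrans c g))"
  then have A: "A \<in> sets \<nu>" by simp
  then have "A \<subseteq> space \<nu>" by (rule sets.sets_into_space)
  then have "(\<lambda>c. rtrans c g) -` A \<inter> space \<nu> = (\<lambda>c. rtrans c (- g)) ` A"
    using rtrans_in_space by (force simp: rtrans_rtrans)
  moreover have "emeasure \<nu> ((\<lambda>c. rtrans c (- g)) ` A) = emeasure \<nu> A"
    using finite_invariant A by (simp add: finite_invariant_measure_def)
  ultimately show "emeasure (distr \<nu> \<nu> (\<lambda>c. rtrans c g)) A = emeasure \<nu> A"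
    using A measurable_right_translation by (simp add: emeasure_distr)
qed simp

lemma integral_right_translation:
  fixes F :: "'g set \<Rightarrow> 'b::{banach, second_countable_topology}"
  assumes "F \<in> borel_measurable \<nu>"
  shows "(\<integral>c. F (rtrans c g) \<partial>\<nu>) = (\<integral>c. F c \<partial>\<nu>)"
  using integral_distr[OF measurable_right_translation assms, of g]
  by (simp add: distr_right_translation)

lemma rtrans_eq_of_mem:
  assumes "y \<in> rtrans \<Gamma> x"
  shows "rtrans \<Gamma> y = rtrans \<Gamma> x"
proof -
  obtain \<gamma> where "\<gamma> \<in> \<Gamma>" "y = \<gamma> + x" using assms by (auto simp: rtrans_def)
  then show ?thesis
    using rtrans_subgroup[OF subgroup, of \<gamma>] by (simp flip: rtrans_rtrans)
qed

text \<open>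
  For compactly supported \<open>f\<close> the sum is locally finite, and the same finite set of \<open>\<gamma>\<close> serves all
  \<open>x\<close> in a ball. Continuity of the periodization and the later interchange of sum and integral rest on
  this uniformity.
\<close>
lemma periodization_eq_sum:
  assumes supp: "\<And>y. len y \<ge> r \<Longrightarrow> f y = 0" and "r + len x \<le> R"
  shows "periodization f (rtrans \<Gamma> x) = (\<Sum>\<gamma>\<in>{\<gamma>\<in>\<Gamma>. len \<gamma> \<le> R}. f (\<gamma> + x))"
proof -
  have "periodization f (rtrans \<Gamma> x) = (\<Sum>\<^sub>\<infinity>\<gamma>\<in>\<Gamma>. f (\<gamma> + x))"
    unfolding periodization_def rtrans_def
    by (subst infsum_reindex) (auto simp: inj_on_def o_def)
  also have "\<dots> = (\<Sum>\<^sub>\<infinity>\<gamma>\<in>{\<gamma>\<in>\<Gamma>. len \<gamma> \<le> R}. f (\<gamma> + x))"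
  proof (rule infsum_cong_neutral)
    fix \<gamma> assume "\<gamma> \<in> \<Gamma> - {\<gamma>\<in>\<Gamma>. len \<gamma> \<le> R}"
    then have "len (\<gamma> + x) \<ge> r"
      using len_add_ge[of \<gamma> x] assms(2) by auto
    then show "f (\<gamma> + x) = 0" by (rule supp)
  qed auto
  finally show ?thesis using finite_lattice_ball by simp
qed

lemma continuous_periodization:
  assumes "continuous_on UNIV f" and supp: "\<And>y. len y \<ge> r \<Longrightarrow> f y = 0"
  shows "continuous_on UNIV (\<lambda>x. periodization f (rtrans \<Gamma> x))"
proof -
  have "continuous_on {x. len x < s} (\<lambda>x. periodization f (rtrans \<Gamma> x))" for s
  proof -
    have "continuous_on {x. len x < s} (\<lambda>x. \<Sum>\<gamma>\<in>{\<gamma>\<in>\<Gamma>. len \<gamma> \<le> r + s}. f (\<gamma> + x))"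
      by (intro continuous_intros continuous_on_compose2[OF assms(1)]) auto
    then show ?thesis
      by (rule continuous_on_eq) (rule periodization_eq_sum[symmetric], use supp in auto)
  qed
  then have "continuous_on (\<Union>s\<in>UNIV. {x. len x < s}) (\<lambda>x. periodization f (rtrans \<Gamma> x))"
    using open_len_less by (intro continuous_on_open_UN) auto
  moreover have "(\<Union>s\<in>UNIV. {x. len x < s}) = UNIV"
    using gt_ex by auto
  ultimately show ?thesis by simp
qed

text \<open>
  A coset on which \<open>f\<close> does not vanish has a representative in the support of \<open>f\<close>, and from there only
  the \<open>\<gamma>\<close> with \<open>len \<gamma> \<le> 2 * r\<close> contribute. So the bound is uniform even when the quotient is not
  compact.
\<close>
lemma periodization_bounded:
  fixes B :: real
  assumes supp: "\<And>y. len y \<ge> r \<Longrightarrow> f y = 0" and bound: "\<And>y. \<bar>f y\<bar> \<le> B" and c: "c \<in> space \<nu>"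
  shows "\<bar>periodization f c\<bar> \<le> card {\<gamma>\<in>\<Gamma>. len \<gamma> \<le> 2 * r} * B"
proof (cases "\<exists>y\<in>c. f y \<noteq> 0")
  case True
  then obtain y where y: "y \<in> c" "f y \<noteq> 0" by blast
  then have "len y < r" using supp by (meson not_le_imp_less)
  have "c = rtrans \<Gamma> y" using c y rtrans_eq_of_mem by (auto simp: space_quotient)
  then have "periodization f c = (\<Sum>\<gamma>\<in>{\<gamma>\<in>\<Gamma>. len \<gamma> \<le> 2 * r}. f (\<gamma> + y))"
    using periodization_eq_sum[of r f y "2 * r"] supp \<open>len y < r\<close> by simp
  also have "\<bar>\<dots>\<bar> \<le> (\<Sum>\<gamma>\<in>{\<gamma>\<in>\<Gamma>. len \<gamma> \<le> 2 * r}. B)"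
    using bound by (intro order_trans[OF sum_abs] sum_mono)
  finally show ?thesis by simp
next
  case False
  then have "periodization f c = 0"
    unfolding periodization_def by (intro infsum_0) auto
  moreover have "B \<ge> 0" using bound[of 0] by linarith
  ultimately show ?thesis by simp
qed

text \<open>
  The quotient integral formula applied to \<open>x \<mapsto> h x * F (\<Gamma>x)\<close>: the factor \<open>F\<close> is constant on
  cosets and comes out of the sum.
\<close>
lemma integral_unfold:
  assumes cont: "continuous_on UNIV h" and supp: "\<And>y. len y \<ge> r \<Longrightarrow> h y = 0"
    and F: "continuous_on UNIV (\<lambda>x. F (rtrans \<Gamma> x))"
  shows "(\<integral>x. h x * F (rtrans \<Gamma> x) \<partial>\<mu>) = (\<integral>c. periodization h c * F c \<partial>\<nu>)"
proof -
  let ?f = "\<lambda>x. h x * F (rtrans \<Gamma> x)"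
  have "(\<integral>x. ?f x \<partial>\<mu>) = (\<integral>c. (\<Sum>\<^sub>\<infinity>y\<in>c. ?f y) \<partial>\<nu>)"
  proof -
    have "continuous_on UNIV ?f" using cont F by (rule continuous_on_mult)
    moreover have "\<exists>C. compact C \<and> (\<forall>x. x \<notin> C \<longrightarrow> ?f x = 0)"
      using compact_len_le[of r] supp by (intro exI[of _ "{x. len x \<le> r}"]) auto
    ultimately show ?thesis using quotient unfolding quotient_measure_def by blast
  qed
  also have "\<dots> = (\<integral>c. periodization h c * F c \<partial>\<nu>)"
  proof (rule Bochner_Integration.integral_cong[OF refl])
    fix c assume "c \<in> space \<nu>"
    then obtain x where c: "c = rtrans \<Gamma> x" by (auto simp: space_quotient)
    have "(\<Sum>\<^sub>\<infinity>y\<in>c. ?f y) = (\<Sum>\<^sub>\<infinity>y\<in>c. h y * F c)"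
      using rtrans_eq_of_mem by (intro infsum_cong) (simp add: c)
    then show "(\<Sum>\<^sub>\<infinity>y\<in>c. ?f y) = periodization h c * F c"
      by (simp add: periodization_def infsum_cmult_left')
  qed
  finally show ?thesis .
qed

section \<open>Bump functions and their periodizations\<close>

text \<open>
  A tent of height \<open>\<epsilon>\<close>, normalised to integral one. It depends on \<open>x\<close> only through \<open>len x\<close>, which makes
  it invariant under \<open>K\<close> and measurable in the sense of \<open>measurable_len_product\<close>.
\<close>
definition bump :: "real \<Rightarrow> 'g \<Rightarrow> real" where
  "bump \<epsilon> x = max 0 (\<epsilon> - len x) / (\<integral>y. max 0 (\<epsilon> - len y) \<partial>\<mu>)"

lemma bump_support: "len x \<ge> \<epsilon> \<Longrightarrow> bump \<epsilon> x = 0"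
  by (simp add: bump_def)

lemma bump_nonneg: "bump \<epsilon> x \<ge> 0"
  by (simp add: bump_def)

lemma bump_bounded: "\<bar>bump \<epsilon> x\<bar> \<le> bump \<epsilon> 0"
  unfolding abs_of_nonneg[OF bump_nonneg] unfolding bump_def
  by (intro divide_right_mono max.mono) (auto intro: integral_nonneg_AE)

lemma continuous_bump: "continuous_on UNIV (bump \<epsilon>)"
  unfolding bump_def divide_inverse by (intro continuous_intros)

lemma bump_right_invariant: "len k = 0 \<Longrightarrow> bump \<epsilon> (x + k) = bump \<epsilon> x"
  by (simp add: bump_def len_add_eq)

lemma integral_bump:
  assumes "\<epsilon> > 0"
  shows "(\<integral>x. bump \<epsilon> x \<partial>\<mu>) = 1"
proof -
  let ?tent = "\<lambda>x. max 0 (\<epsilon> - len x)"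
  have int: "integrable \<mu> ?tent"
    by (rule integrable_compact_support[of _ \<epsilon>]) (auto intro!: continuous_intros)
  have "(\<integral>x. ?tent x \<partial>\<mu>) \<noteq> 0"
  proof
    assume "(\<integral>x. ?tent x \<partial>\<mu>) = 0"
    then have "AE x in \<mu>. ?tent x = 0"
      using integral_nonneg_eq_0_iff_AE[OF int] by simp
    then have "AE x in \<mu>. \<not> len x < \<epsilon>" by eventually_elim simp
    then have "emeasure \<mu> {x. len x < \<epsilon>} = 0"
      using AE_iff_measurable[OF ball_in_sets(2)[of \<epsilon>], of "\<lambda>x. \<not> len x < \<epsilon>"] by simp
    then show False using emeasure_ball_pos[OF assms] by contradiction
  qed
  then show ?thesis by (simp add: bump_def)
qed

lemma integrable_bump: "integrable \<mu> (bump \<epsilon>)"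
  using continuous_bump bump_support by (rule integrable_compact_support)

lemma nn_integral_bump: "\<epsilon> > 0 \<Longrightarrow> (\<integral>\<^sup>+x. bump \<epsilon> x \<partial>\<mu>) = 1"
  using integral_bump[of \<epsilon>] nn_integral_eq_integral[OF integrable_bump[of \<epsilon>]] bump_nonneg by simp

abbreviation "theta \<epsilon> \<equiv> periodization (bump \<epsilon>)"

lemma continuous_theta: "continuous_on UNIV (\<lambda>x. theta \<epsilon> (rtrans \<Gamma> x))"
  using continuous_bump bump_support by (rule continuous_periodization)

lemma continuous_theta_translate: "continuous_on UNIV (\<lambda>x. theta \<epsilon> (rtrans \<Gamma> (x + z)))"
  by (rule continuous_on_compose2[OF continuous_theta]) (auto intro: continuous_intros)

lemma measurable_theta: "theta \<epsilon> \<in> borel_measurable \<nu>"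
  using continuous_theta by (rule borel_measurable_quotientI)

lemma theta_bounded:
  obtains B where "\<And>c. c \<in> space \<nu> \<Longrightarrow> \<bar>theta \<epsilon> c\<bar> \<le> B"
  using periodization_bounded[of \<epsilon> "bump \<epsilon>", OF bump_support bump_bounded] by blast

lemma theta_nonneg: "theta \<epsilon> c \<ge> 0"
  unfolding periodization_def by (intro infsum_nonneg bump_nonneg)

lemma integral_theta:
  assumes "\<epsilon> > 0"
  shows "(\<integral>c. theta \<epsilon> c \<partial>\<nu>) = 1"
  using integral_unfold[of "bump \<epsilon>" \<epsilon> "\<lambda>_. 1"] continuous_bump bump_support integral_bump[OF assms]
  by simp

text \<open>
  The matrix coefficient of \<open>theta \<epsilon>\<close> with itself, for right translation on the whole of $L^2$ rather
  than $L^2_0$.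
\<close>
definition correlation :: "real \<Rightarrow> 'g \<Rightarrow> real" where
  "correlation \<epsilon> z = (\<integral>c. theta \<epsilon> (rtrans c z) * theta \<epsilon> c \<partial>\<nu>)"

lemma correlation_eq_haar:
  "correlation \<epsilon> z = (\<integral>x. bump \<epsilon> x * theta \<epsilon> (rtrans \<Gamma> (x + z)) \<partial>\<mu>)"
  unfolding correlation_def
  using integral_unfold[of "bump \<epsilon>" \<epsilon> "\<lambda>c. theta \<epsilon> (rtrans c z)"] continuous_bump bump_support
    continuous_theta_translate
  by (simp add: rtrans_rtrans mult.commute)

lemma integrable_quotient_bounded:
  fixes F :: "'g set \<Rightarrow> 'b::{banach, second_countable_topology}"
  assumes "F \<in> borel_measurable \<nu>" "\<And>c. c \<in> space \<nu> \<Longrightarrow> norm (F c) \<le> B"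
  shows "integrable \<nu> F"
  using finite_measure.integrable_const_bound[OF finite_measure_quotient, of F B] assms by auto

lemma correlation_bounded:
  obtains M where "\<And>z. correlation \<epsilon> z \<le> M" "M \<ge> 0"
proof -
  obtain B where B: "\<And>c. c \<in> space \<nu> \<Longrightarrow> \<bar>theta \<epsilon> c\<bar> \<le> B"
    using theta_bounded by blast
  interpret finite_measure \<nu> by (rule finite_measure_quotient)
  have "correlation \<epsilon> z \<le> B * B * measure \<nu> (space \<nu>)" for z
  proof -
    have "correlation \<epsilon> z \<le> (\<integral>c. B * B \<partial>\<nu>)"
      unfolding correlation_def
    proof (rule integral_mono')
      fix c assume c: "c \<in> space \<nu>"
      have "0 \<le> B" using B[OF c] by linarith
      then show "theta \<epsilon> (rtrans c z) * theta \<epsilon> c \<le> B * B"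
        using B[OF c] B[OF rtrans_in_space[OF c, of z]] theta_nonneg[of \<epsilon>]
        by (intro mult_mono) auto
    qed (auto intro: mult_nonneg_nonneg theta_nonneg)
    then show ?thesis by (simp add: mult.commute)
  qed
  then show thesis
    using that[of "B * B * measure \<nu> (space \<nu>)"] by (simp add: zero_le_mult_iff linorder_linear)
qed

text \<open>
  Subtracting the mean \<open>1 / V\<close> from \<open>theta \<epsilon>\<close> gives an element of $L^2_0$ whose matrix coefficient is
  \<open>correlation \<epsilon> z - 1 / V\<close>. It is invariant under \<open>K\<close> because \<open>bump \<epsilon>\<close> is, so mixing applies; a compact
  set is contained in some ball.
\<close>
lemma correlation_limit:
  assumes mixing: "acts_K_mixingly K \<nu>" and K: "\<And>k. k \<in> K \<Longrightarrow> len k = 0"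
    and "\<epsilon> > 0" "\<delta> > 0"
  obtains R where "\<And>z. len z > R \<Longrightarrow> \<bar>correlation \<epsilon> z - 1 / measure \<nu> (space \<nu>)\<bar> < \<delta>"
proof -
  define V where "V = measure \<nu> (space \<nu>)"
  define u where "u c = theta \<epsilon> c - 1 / V" for c
  define v where "v c = complex_of_real (u c)" for c
  have "V > 0" using vol_pos by (simp add: V_def)
  interpret finite_measure \<nu> by (rule finite_measure_quotient)
  obtain B where B: "\<And>c. c \<in> space \<nu> \<Longrightarrow> \<bar>theta \<epsilon> c\<bar> \<le> B"
    using theta_bounded by blast
  have uB: "\<bar>u c\<bar> \<le> B + 1 / V" if "c \<in> space \<nu>" for c
    using B[OF that] \<open>V > 0\<close> unfolding u_def by (intro order_trans[OF abs_triangle_ineq4]) simp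
  have [measurable]: "theta \<epsilon> \<in> borel_measurable \<nu>" by (rule measurable_theta)
  have [measurable]: "u \<in> borel_measurable \<nu>" unfolding u_def by measurable
  have [measurable]: "(\<lambda>c. theta \<epsilon> (rtrans c z)) \<in> borel_measurable \<nu>" for z
    using measurable_compose[OF measurable_right_translation measurable_theta] .
  have int: "integrable \<nu> (theta \<epsilon>)" "integrable \<nu> (\<lambda>c. theta \<epsilon> (rtrans c z))"
      "integrable \<nu> (\<lambda>c. theta \<epsilon> (rtrans c z) * theta \<epsilon> c)" for z
  proof -
    show "integrable \<nu> (theta \<epsilon>)" "integrable \<nu> (\<lambda>c. theta \<epsilon> (rtrans c z))"
      using B rtrans_in_space by (auto intro!: integrable_quotient_bounded[where B=B])
    show "integrable \<nu> (\<lambda>c. theta \<epsilon> (rtrans c z) * theta \<epsilon> c)"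
    proof (rule integrable_quotient_bounded[where B="B * B"])
      fix c assume c: "c \<in> space \<nu>"
      have "0 \<le> B" using B[OF c] by linarith
      then show "norm (theta \<epsilon> (rtrans c z) * theta \<epsilon> c) \<le> B * B"
        using B[OF c] B[OF rtrans_in_space[OF c, of z]]
        by (simp only: real_norm_def abs_mult) (intro mult_mono, auto)
    qed measurable
  qed
  have "(\<integral>c. u c \<partial>\<nu>) = 0"
    using integral_theta[OF \<open>\<epsilon> > 0\<close>] \<open>V > 0\<close> int(1) by (simp add: u_def V_def)
  moreover have "integrable \<nu> (\<lambda>c. (u c)\<^sup>2)"
  proof (rule integrable_quotient_bounded[where B="(B + 1 / V)\<^sup>2"])
    fix c assume "c \<in> space \<nu>"
    then show "norm ((u c)\<^sup>2) \<le> (B + 1 / V)\<^sup>2"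
      using power_mono[OF uB, of c 2] by simp
  qed measurable
  moreover have "v \<in> borel_measurable \<nu>" unfolding v_def by measurable
  moreover have "(\<integral>c. v c \<partial>\<nu>) = complex_of_real (\<integral>c. u c \<partial>\<nu>)"
    unfolding v_def by (rule integral_complex_of_real)
  moreover have "(cmod (v c))\<^sup>2 = (u c)\<^sup>2" for c
    by (simp add: v_def)
  ultimately have "v \<in> L20 \<nu>"
    by (simp add: L20_def)
  have coeff: "matrix_coefficient \<nu> v v z = complex_of_real (correlation \<epsilon> z - 1 / V)" for z
  proof -
    have "matrix_coefficient \<nu> v v z = (\<integral>c. complex_of_real (u (rtrans c z) * u c) \<partial>\<nu>)"
      by (simp add: matrix_coefficient_def L2_inner_def right_translation_def v_def)
    also have "\<dots> = complex_of_real (\<integral>c. u (rtrans c z) * u c \<partial>\<nu>)"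
      by (rule integral_complex_of_real)
    also have "(\<integral>c. u (rtrans c z) * u c \<partial>\<nu>)
      = (\<integral>c. theta \<epsilon> (rtrans c z) * theta \<epsilon> c - 1 / V * theta \<epsilon> (rtrans c z) - 1 / V * theta \<epsilon> c + 1 / V * (1 / V) \<partial>\<nu>)"
      by (simp add: u_def algebra_simps)
    also have "\<dots> = correlation \<epsilon> z - 1 / V * 1 - 1 / V * 1 + 1 / V * (1 / V) * V"
      using int integral_right_translation[OF measurable_theta, of \<epsilon> z] integral_theta[OF \<open>\<epsilon> > 0\<close>]
      by (simp add: correlation_def V_def)
    also have "\<dots> = correlation \<epsilon> z - 1 / V" using \<open>V > 0\<close> by simp
    finally show ?thesis .
  qed
  have theta_K: "theta \<epsilon> (rtrans c k) = theta \<epsilon> c" if "k \<in> K" for c k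
    unfolding periodization_def rtrans_def using K[OF that]
    by (subst infsum_reindex) (auto simp: inj_on_def o_def bump_right_invariant)
  have "K_invariant K (matrix_coefficient \<nu> v v)"
    unfolding K_invariant_def coeff
  proof (intro allI ballI conjI)
    fix x k assume "k \<in> K"
    show "complex_of_real (correlation \<epsilon> (x + k) - 1 / V) = complex_of_real (correlation \<epsilon> x - 1 / V)"
      using theta_K[OF \<open>k \<in> K\<close>] by (simp add: correlation_def flip: rtrans_rtrans)
    have "correlation \<epsilon> (k + x) = (\<integral>c. theta \<epsilon> (rtrans (rtrans c k) x) * theta \<epsilon> (rtrans c k) \<partial>\<nu>)"
      using theta_K[OF \<open>k \<in> K\<close>] by (simp add: correlation_def rtrans_rtrans)
    also have "\<dots> = correlation \<epsilon> x"
      unfolding correlation_def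
      by (rule integral_right_translation[where F="\<lambda>c. theta \<epsilon> (rtrans c x) * theta \<epsilon> c"]) measurable
    finally show "complex_of_real (correlation \<epsilon> (k + x) - 1 / V) = complex_of_real (correlation \<epsilon> x - 1 / V)"
      by simp
  qed
  then have "vanishes_at_infinity (matrix_coefficient \<nu> v v)"
    using mixing \<open>v \<in> L20 \<nu>\<close> by (simp add: acts_K_mixingly_def)
  then obtain C where C: "compact C" "\<And>z. z \<notin> C \<Longrightarrow> cmod (matrix_coefficient \<nu> v v z) < \<delta>"
    using \<open>\<delta> > 0\<close> unfolding vanishes_at_infinity_def by blast
  have "compact (len ` C)"
    using C(1) by (intro compact_continuous_image continuous_intros)
  then obtain R where R: "\<And>z. z \<in> C \<Longrightarrow> \<bar>len z\<bar> \<le> R"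
    using compact_imp_bounded[of "len ` C"] unfolding bounded_iff by auto
  show thesis
  proof (rule that)
    fix z assume "len z > R"
    then have "z \<notin> C" using R by force
    then show "\<bar>correlation \<epsilon> z - 1 / measure \<nu> (space \<nu>)\<bar> < \<delta>"
      using C(2)[of z] unfolding coeff norm_of_real by (simp add: V_def)
  qed
qed

text \<open>
  The indicator of \<open>len \<gamma> \<le> T\<close>, averaged over perturbations \<open>- x + \<gamma> + y\<close> with \<open>x\<close> and \<open>y\<close> near
  \<open>0\<close>.
\<close>
definition smoothed :: "real \<Rightarrow> real \<Rightarrow> 'g \<Rightarrow> ennreal" where
  "smoothed \<epsilon> T \<gamma> =
    (\<integral>\<^sup>+x. \<integral>\<^sup>+y. ennreal (bump \<epsilon> x * bump \<epsilon> y) * indicator {w. len w \<le> T} (- x + \<gamma> + y) \<partial>\<mu> \<partial>\<mu>)"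

lemma measurable_bump [measurable]: "bump \<epsilon> \<in> borel_measurable borel"
  by (rule borel_measurable_continuous_onI[OF continuous_bump])

lemma measurable_bump_haar [measurable]: "bump \<epsilon> \<in> borel_measurable \<mu>"
  by (subst measurable_cong_sets[OF sets_haar refl]) (rule measurable_bump)

lemma nn_integral_bump_bump:
  assumes "\<epsilon> > 0"
  shows "(\<integral>\<^sup>+x. \<integral>\<^sup>+y. ennreal (bump \<epsilon> x * bump \<epsilon> y) \<partial>\<mu> \<partial>\<mu>) = 1"
proof -
  have "(\<integral>\<^sup>+y. ennreal (bump \<epsilon> x * bump \<epsilon> y) \<partial>\<mu>) = ennreal (bump \<epsilon> x)" for x
  proof -
    have "(\<integral>\<^sup>+y. ennreal (bump \<epsilon> x * bump \<epsilon> y) \<partial>\<mu>) = (\<integral>\<^sup>+y. ennreal (bump \<epsilon> x) * ennreal (bump \<epsilon> y) \<partial>\<mu>)"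
      by (intro nn_integral_cong ennreal_mult bump_nonneg)
    also have "\<dots> = ennreal (bump \<epsilon> x) * (\<integral>\<^sup>+y. ennreal (bump \<epsilon> y) \<partial>\<mu>)"
      by (rule nn_integral_cmult) measurable
    finally show ?thesis by (simp add: nn_integral_bump[OF assms])
  qed
  then show ?thesis by (simp add: nn_integral_bump[OF assms])
qed

lemma smoothed_le_1:
  assumes "\<epsilon> > 0"
  shows "smoothed \<epsilon> T \<gamma> \<le> 1"
proof -
  have "smoothed \<epsilon> T \<gamma> \<le> (\<integral>\<^sup>+x. \<integral>\<^sup>+y. ennreal (bump \<epsilon> x * bump \<epsilon> y) \<partial>\<mu> \<partial>\<mu>)"
    unfolding smoothed_def by (intro nn_integral_mono) (auto split: split_indicator)
  then show ?thesis using nn_integral_bump_bump[OF assms] by simp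
qed

lemma smoothed_eq_1:
  assumes "\<epsilon> > 0" and \<gamma>: "len \<gamma> + 2 * \<epsilon> \<le> T"
  shows "smoothed \<epsilon> T \<gamma> = 1"
proof -
  have "ennreal (bump \<epsilon> x * bump \<epsilon> y) * indicator {w. len w \<le> T} (- x + \<gamma> + y)
      = ennreal (bump \<epsilon> x * bump \<epsilon> y)" for x y
  proof (cases "len x < \<epsilon> \<and> len y < \<epsilon>")
    case True
    have "len (- x + \<gamma> + y) \<le> len x + len \<gamma> + len y"
      using len_add[of "- x + \<gamma>" y] len_add[of "- x" \<gamma>] by simp
    then show ?thesis using True \<gamma> by (simp add: indicator_def)
  next
    case False
    then have "bump \<epsilon> x * bump \<epsilon> y = 0" using bump_support[of \<epsilon> x] bump_support[of \<epsilon> y] by auto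
    then show ?thesis by (simp only: ennreal_0 mult_zero_left)
  qed
  then show ?thesis using nn_integral_bump_bump[OF assms(1)] by (simp add: smoothed_def)
qed

lemma measurable_bump_product:
  "(\<lambda>(x, z). bump \<epsilon> (a + x + z)) \<in> borel_measurable (\<mu> \<Otimes>\<^sub>M \<mu>)"
proof -
  have "(\<lambda>w. len (a + fst w + snd w)) \<in> borel_measurable (\<mu> \<Otimes>\<^sub>M \<mu>)"
    using measurable_len_product[of a] unfolding case_prod_unfold
    by (subst measurable_cong_sets[OF sets_pair_measure_cong[OF sets_haar sets_haar] refl])
  then show ?thesis unfolding bump_def case_prod_unfold by measurable
qed

text \<open>
  For each \<open>\<gamma>\<close>, substitute \<open>y = - \<gamma> + x + z\<close> by left invariance and integrate over \<open>x\<close> first. The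
  sum of \<open>bump \<epsilon> (- \<gamma> + x + z)\<close> over the lattice is \<open>theta \<epsilon>\<close> at the coset of \<open>x + z\<close>, and the
  integral over \<open>x\<close> unfolds to the correlation. The set of \<open>\<gamma>\<close> on the left is large enough: when
  \<open>len x < \<epsilon>\<close> and \<open>len z \<le> T\<close>, every other \<open>\<gamma>\<close> gives a zero term.
\<close>
lemma sum_smoothed_eq_integral:
  assumes "\<epsilon> > 0"
  shows "(\<Sum>\<gamma>\<in>{\<gamma>\<in>\<Gamma>. len \<gamma> \<le> T + 2 * \<epsilon>}. smoothed \<epsilon> T \<gamma>)
    = (\<integral>\<^sup>+z. ennreal (correlation \<epsilon> z) * indicator {z. len z \<le> T} z \<partial>\<mu>)"
proof -
  let ?S = "{\<gamma>\<in>\<Gamma>. len \<gamma> \<le> T + 2 * \<epsilon>}" and ?B = "{z. len z \<le> T}"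
  let ?f = "\<lambda>\<gamma> x z. ennreal (bump \<epsilon> x * bump \<epsilon> (- \<gamma> + x + z)) * indicator ?B z"
  interpret sigma_finite_measure \<mu> by (rule sigma_finite_haar)
  interpret pair_sigma_finite \<mu> \<mu> ..
  have [measurable]: "?B \<in> sets \<mu>" "?B \<in> sets borel" by (rule ball_in_sets) (use ball_in_sets sets_haar in blast)
  have f [measurable]: "case_prod (?f \<gamma>) \<in> borel_measurable (\<mu> \<Otimes>\<^sub>M \<mu>)" for \<gamma>
    using measurable_bump_product[of \<epsilon> "- \<gamma>"] unfolding case_prod_unfold by measurable
  have translate: "smoothed \<epsilon> T \<gamma> = (\<integral>\<^sup>+x. \<integral>\<^sup>+z. ?f \<gamma> x z \<partial>\<mu> \<partial>\<mu>)" for \<gamma>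
    unfolding smoothed_def
  proof (rule nn_integral_cong)
    fix x
    let ?g = "\<lambda>y. ennreal (bump \<epsilon> x * bump \<epsilon> y) * indicator ?B (- x + \<gamma> + y)"
    have [measurable]: "(\<lambda>y. - x + \<gamma> + y) \<in> borel \<rightarrow>\<^sub>M borel"
      by (rule measurable_left_translation)
    have "(\<integral>\<^sup>+y. ?g y \<partial>\<mu>) = (\<integral>\<^sup>+z. ?g (- \<gamma> + x + z) \<partial>\<mu>)"
      by (rule nn_integral_left_translation[symmetric]) measurable
    also have "(\<lambda>z. ?g (- \<gamma> + x + z)) = ?f \<gamma> x"
      by (simp add: add.assoc)
    finally show "(\<integral>\<^sup>+y. ?g y \<partial>\<mu>) = (\<integral>\<^sup>+z. ?f \<gamma> x z \<partial>\<mu>)" .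
  qed
  have "(\<Sum>\<gamma>\<in>?S. smoothed \<epsilon> T \<gamma>) = (\<integral>\<^sup>+z. \<integral>\<^sup>+x. (\<Sum>\<gamma>\<in>?S. ?f \<gamma> x z) \<partial>\<mu> \<partial>\<mu>)"
    unfolding translate Fubini'[OF f, symmetric]
    by (subst nn_integral_sum) (auto simp: nn_integral_sum)
  also have "\<dots> = (\<integral>\<^sup>+z. ennreal (correlation \<epsilon> z) * indicator ?B z \<partial>\<mu>)"
  proof (rule nn_integral_cong)
    fix z
    show "(\<integral>\<^sup>+x. (\<Sum>\<gamma>\<in>?S. ?f \<gamma> x z) \<partial>\<mu>) = ennreal (correlation \<epsilon> z) * indicator ?B z"
    proof (cases "len z \<le> T")
      case True
      have "(\<Sum>\<gamma>\<in>?S. ?f \<gamma> x z) = ennreal (bump \<epsilon> x * theta \<epsilon> (rtrans \<Gamma> (x + z)))" for x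
      proof (cases "len x < \<epsilon>")
        case x: True
        have "bij_betw uminus ?S ?S"
          using subgroup by (intro bij_betwI[where g=uminus]) (auto simp: is_subgroup_def)
        then have "(\<Sum>\<gamma>\<in>?S. bump \<epsilon> (- \<gamma> + x + z)) = (\<Sum>\<gamma>\<in>?S. bump \<epsilon> (\<gamma> + (x + z)))"
          using sum.reindex_bij_betw[of uminus ?S ?S "\<lambda>\<gamma>. bump \<epsilon> (\<gamma> + (x + z))"]
          by (simp add: add.assoc)
        also have "\<dots> = theta \<epsilon> (rtrans \<Gamma> (x + z))"
          using len_add[of x z] x True bump_support
          by (intro periodization_eq_sum[symmetric]) auto
        finally have sum: "(\<Sum>\<gamma>\<in>?S. bump \<epsilon> (- \<gamma> + x + z)) = theta \<epsilon> (rtrans \<Gamma> (x + z))" .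
        have "(\<Sum>\<gamma>\<in>?S. ?f \<gamma> x z) = (\<Sum>\<gamma>\<in>?S. ennreal (bump \<epsilon> x * bump \<epsilon> (- \<gamma> + x + z)))"
          using True by simp
        also have "\<dots> = ennreal (\<Sum>\<gamma>\<in>?S. bump \<epsilon> x * bump \<epsilon> (- \<gamma> + x + z))"
          by (intro sum_ennreal mult_nonneg_nonneg bump_nonneg)
        finally show ?thesis by (simp only: sum flip: sum_distrib_left)
      qed (simp add: bump_support)
      then have "(\<integral>\<^sup>+x. (\<Sum>\<gamma>\<in>?S. ?f \<gamma> x z) \<partial>\<mu>) = (\<integral>\<^sup>+x. ennreal (bump \<epsilon> x * theta \<epsilon> (rtrans \<Gamma> (x + z))) \<partial>\<mu>)"
        by simp
      also have "\<dots> = ennreal (correlation \<epsilon> z)"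
        unfolding correlation_eq_haar
      proof (rule nn_integral_eq_integral)
        show "integrable \<mu> (\<lambda>x. bump \<epsilon> x * theta \<epsilon> (rtrans \<Gamma> (x + z)))"
          using continuous_on_mult[OF continuous_bump continuous_theta_translate]
          by (rule integrable_compact_support[of _ \<epsilon>]) (simp add: bump_support)
        show "AE x in \<mu>. 0 \<le> bump \<epsilon> x * theta \<epsilon> (rtrans \<Gamma> (x + z))"
          by (intro AE_I2 mult_nonneg_nonneg bump_nonneg theta_nonneg)
      qed
      finally show ?thesis using True by simp
    qed simp
  qed
  finally show ?thesis .
qed

text \<open>
  Outside a fixed ball of radius \<open>R\<close> the correlation is within \<open>\<delta>\<close> of its limit; the ball itself
  contributes an amount that does not depend on \<open>T\<close> and goes into \<open>C\<close>.
\<close>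
lemma lattice_count_bounds:
  assumes mixing: "acts_K_mixingly K \<nu>" and K: "\<And>k. k \<in> K \<Longrightarrow> len k = 0"
    and "\<epsilon> > 0" "\<delta> > 0"
  shows "\<exists>C. \<forall>T.
     card {\<gamma>\<in>\<Gamma>. len \<gamma> \<le> T - \<epsilon>} \<le> (1 / measure \<nu> (space \<nu>) + \<delta>) * measure \<mu> {x. len x \<le> T} + C \<and>
     (1 / measure \<nu> (space \<nu>) - \<delta>) * measure \<mu> {x. len x \<le> T} - C \<le> card {\<gamma>\<in>\<Gamma>. len \<gamma> \<le> T + \<epsilon>}"
proof -
  define a where "a = 1 / measure \<nu> (space \<nu>)"
  \<comment> \<open>Smoothing at scale \<open>e\<close> shifts radii by \<open>2 * e\<close>.\<close>
  define e where "e = \<epsilon> / 2"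
  have e: "e > 0" "2 * e = \<epsilon>" using \<open>\<epsilon> > 0\<close> by (simp_all add: e_def)
  have "a > 0" using vol_pos by (simp add: a_def)
  obtain R where R: "\<And>z. len z > R \<Longrightarrow> \<bar>correlation e z - a\<bar> < \<delta>"
    using correlation_limit[OF mixing K e(1) \<open>\<delta> > 0\<close>] unfolding a_def by blast
  obtain M where M: "\<And>z. correlation e z \<le> M" "M \<ge> 0" using correlation_bounded by blast
  let ?b = "\<lambda>T. measure \<mu> {x. len x \<le> T}"
  have em: "emeasure \<mu> {x. len x \<le> T} = ennreal (?b T)" for T
    using emeasure_ball_finite by (simp add: emeasure_eq_ennreal_measure)
  have [measurable]: "{x. len x \<le> T} \<in> sets \<mu>" for T by (rule ball_in_sets)
  define C where "C = (M + a) * ?b R"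
  have "C \<ge> M * ?b R" "C \<ge> a * ?b R" using M \<open>a > 0\<close> by (simp_all add: C_def algebra_simps)
  show ?thesis
    unfolding a_def[symmetric]
  proof (intro exI[of _ C] allI conjI)
    fix T
    let ?I = "\<integral>\<^sup>+z. ennreal (correlation e z) * indicator {z. len z \<le> T} z \<partial>\<mu>"
    let ?S = "{\<gamma>\<in>\<Gamma>. len \<gamma> \<le> T + 2 * e}"
    have I: "?I = (\<Sum>\<gamma>\<in>?S. smoothed e T \<gamma>)"
      using sum_smoothed_eq_integral[OF e(1)] by simp
    have "ennreal (card {\<gamma>\<in>\<Gamma>. len \<gamma> \<le> T - \<epsilon>}) = (\<Sum>\<gamma>\<in>{\<gamma>\<in>\<Gamma>. len \<gamma> \<le> T - \<epsilon>}. smoothed e T \<gamma>)"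
      using smoothed_eq_1[OF e(1)] e(2) by (simp add: ennreal_of_nat_eq_real_of_nat)
    also have "\<dots> \<le> ?I"
      unfolding I using e finite_lattice_ball by (intro sum_mono2) auto
    also have "\<dots> \<le> (\<integral>\<^sup>+z. ennreal (a + \<delta>) * indicator {z. len z \<le> T} z + ennreal M * indicator {z. len z \<le> R} z \<partial>\<mu>)"
    proof (rule nn_integral_mono)
      fix z
      have "correlation e z \<le> a + \<delta>" if "\<not> len z \<le> R" using R[of z] that by auto
      then show "ennreal (correlation e z) * indicator {z. len z \<le> T} z
          \<le> ennreal (a + \<delta>) * indicator {z. len z \<le> T} z + ennreal M * indicator {z. len z \<le> R} z"
        using M(1)[of z] by (auto split: split_indicator intro!: ennreal_leI intro: add_increasing)
    qed
    also have "\<dots> = ennreal (a + \<delta>) * ennreal (?b T) + ennreal M * ennreal (?b R)"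
      by (simp add: nn_integral_add nn_integral_cmult_indicator em)
    also have "\<dots> = ennreal ((a + \<delta>) * ?b T + M * ?b R)"
      using \<open>a > 0\<close> \<open>\<delta> > 0\<close> M by (simp add: ennreal_mult)
    finally have "real (card {\<gamma>\<in>\<Gamma>. len \<gamma> \<le> T - \<epsilon>}) \<le> (a + \<delta>) * ?b T + M * ?b R"
      using \<open>a > 0\<close> \<open>\<delta> > 0\<close> M by (subst (asm) ennreal_le_iff) auto
    then show "real (card {\<gamma>\<in>\<Gamma>. len \<gamma> \<le> T - \<epsilon>}) \<le> (a + \<delta>) * ?b T + C"
      using \<open>C \<ge> M * ?b R\<close> by simp
    show "(a - \<delta>) * ?b T - C \<le> real (card {\<gamma>\<in>\<Gamma>. len \<gamma> \<le> T + \<epsilon>})"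
    proof (cases "\<delta> < a")
      case True
      let ?D = "{x. len x \<le> T} - {x. len x \<le> R}"
      have "emeasure \<mu> ?D \<le> emeasure \<mu> {x. len x \<le> T}" by (intro emeasure_mono) auto
      then have D: "emeasure \<mu> ?D = ennreal (measure \<mu> ?D)"
        using em[of T] by (intro emeasure_eq_ennreal_measure) (auto simp: top_unique)
      have "emeasure \<mu> {x. len x \<le> T} \<le> emeasure \<mu> (?D \<union> {x. len x \<le> R})"
        by (intro emeasure_mono) auto
      also have "\<dots> \<le> emeasure \<mu> ?D + emeasure \<mu> {x. len x \<le> R}"
        by (intro emeasure_subadditive) auto
      finally have b: "?b T \<le> measure \<mu> ?D + ?b R"
        unfolding D em by (simp flip: ennreal_plus)
      have "ennreal ((a - \<delta>) * measure \<mu> ?D) = (\<integral>\<^sup>+z. ennreal (a - \<delta>) * indicator ?D z \<partial>\<mu>)"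
        using True by (simp add: nn_integral_cmult_indicator D ennreal_mult)
      also have "\<dots> \<le> ?I"
      proof (rule nn_integral_mono)
        fix z
        have "a - \<delta> \<le> correlation e z" if "\<not> len z \<le> R" using R[of z] that by auto
        then show "ennreal (a - \<delta>) * indicator ?D z \<le> ennreal (correlation e z) * indicator {z. len z \<le> T} z"
          by (auto split: split_indicator intro!: ennreal_leI)
      qed
      also have "?I \<le> (\<Sum>\<gamma>\<in>?S. 1)" unfolding I by (intro sum_mono smoothed_le_1 e)
      also have "\<dots> = ennreal (card {\<gamma>\<in>\<Gamma>. len \<gamma> \<le> T + \<epsilon>})" by (simp add: e(2) ennreal_of_nat_eq_real_of_nat)
      finally have "(a - \<delta>) * measure \<mu> ?D \<le> card {\<gamma>\<in>\<Gamma>. len \<gamma> \<le> T + \<epsilon>}"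
        by (subst (asm) ennreal_le_iff) auto
      moreover have "(a - \<delta>) * ?b T \<le> (a - \<delta>) * measure \<mu> ?D + (a - \<delta>) * ?b R"
        using mult_left_mono[OF b, of "a - \<delta>"] True by (simp add: algebra_simps)
      moreover have "(a - \<delta>) * ?b R \<le> a * ?b R"
        using \<open>\<delta> > 0\<close> by (intro mult_right_mono) auto
      ultimately have "(a - \<delta>) * ?b T \<le> card {\<gamma>\<in>\<Gamma>. len \<gamma> \<le> T + \<epsilon>} + a * ?b R" by linarith
      then show ?thesis using \<open>C \<ge> a * ?b R\<close> by simp
    next
      case False
      then have "(a - \<delta>) * ?b T \<le> 0" by (intro mult_nonpos_nonneg) auto
      moreover have "C \<ge> 0" using M \<open>a > 0\<close> by (simp add: C_def)
      ultimately show ?thesis by linarith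
    qed
  qed
qed

end

section \<open>Regular growth and the asymptotic formula\<close>

text \<open>
  By monotonicity the lower limit is at most one and the upper limit at least one, so a common limit
  \<open>L\<close> of the two as \<open>\<epsilon>\<close> tends to zero must be one.
\<close>
lemma regular_growth_eventually:
  assumes reg: "regular_growth b" and "mono b" and "\<eta> > 0"
  obtains \<epsilon> where "\<epsilon> > 0"
    "eventually (\<lambda>T. b (T + \<epsilon>) \<le> (1 + \<eta>) * b T) at_top"
    "eventually (\<lambda>T. (1 - \<eta>) * b T \<le> b (T - \<epsilon>)) at_top"
proof -
  let ?lower = "\<lambda>\<epsilon>. Liminf at_top (\<lambda>T. ereal (b (T - \<epsilon>) / b T))"
  let ?upper = "\<lambda>\<epsilon>. Limsup at_top (\<lambda>T. ereal (b (T + \<epsilon>) / b T))"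
  obtain L where lower: "(?lower \<longlongrightarrow> L) (at_right 0)" and upper: "(?upper \<longlongrightarrow> L) (at_right 0)"
    and lim: "filterlim b at_top at_top"
    using reg unfolding regular_growth_def by auto
  have pos: "eventually (\<lambda>T. b T > 0) at_top"
    using lim by (simp add: filterlim_at_top_dense)
  have gt0: "eventually (\<lambda>\<epsilon>::real. \<epsilon> > 0) (at_right 0)"
    by (rule eventually_at_right_less)
  have "?lower \<epsilon> \<le> 1" if "\<epsilon> > 0" for \<epsilon>
  proof (rule Liminf_le)
    show "\<forall>\<^sub>F T in at_top. ereal (b (T - \<epsilon>) / b T) \<le> 1"
      using pos
    proof eventually_elim
      case (elim T)
      have "b (T - \<epsilon>) \<le> b T"
        using \<open>mono b\<close> that by (auto intro: monoD)
      then show ?case using elim by (simp add: one_ereal_def)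
    qed
  qed simp
  then have "L \<le> 1"
    using lower gt0 by (intro tendsto_upperbound[OF lower]) (auto elim: eventually_mono)
  moreover have "1 \<le> ?upper \<epsilon>" if "\<epsilon> > 0" for \<epsilon>
  proof (rule le_Limsup)
    show "\<forall>\<^sub>F T in at_top. 1 \<le> ereal (b (T + \<epsilon>) / b T)"
      using pos
    proof eventually_elim
      case (elim T)
      have "b T \<le> b (T + \<epsilon>)"
        using \<open>mono b\<close> that by (auto intro: monoD)
      then show ?case using elim by (simp add: one_ereal_def)
    qed
  qed simp
  then have "1 \<le> L"
    using upper gt0 by (intro tendsto_lowerbound[OF upper]) (auto elim: eventually_mono)
  ultimately have "L = 1" by simp
  have "eventually (\<lambda>\<epsilon>. ereal (1 - \<eta>) < ?lower \<epsilon>) (at_right 0)"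
    using \<open>L = 1\<close> \<open>\<eta> > 0\<close> by (intro order_tendstoD(1)[OF lower]) (simp add: one_ereal_def)
  moreover have "eventually (\<lambda>\<epsilon>. ?upper \<epsilon> < ereal (1 + \<eta>)) (at_right 0)"
    using \<open>L = 1\<close> \<open>\<eta> > 0\<close> by (intro order_tendstoD(2)[OF upper]) (simp add: one_ereal_def)
  ultimately have "eventually (\<lambda>\<epsilon>. \<epsilon> > 0 \<and> ereal (1 - \<eta>) < ?lower \<epsilon> \<and> ?upper \<epsilon> < ereal (1 + \<eta>)) (at_right 0)"
    using gt0 by eventually_elim simp
  then obtain \<epsilon> where \<epsilon>: "\<epsilon> > 0" "ereal (1 - \<eta>) < ?lower \<epsilon>" "?upper \<epsilon> < ereal (1 + \<eta>)"
    using eventually_happens'[OF trivial_limit_at_right_real] by blast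
  show thesis
  proof (rule that[OF \<epsilon>(1)])
    show "\<forall>\<^sub>F T in at_top. b (T + \<epsilon>) \<le> (1 + \<eta>) * b T"
      using Limsup_lessD[OF \<epsilon>(3)] pos by eventually_elim (simp add: divide_simps)
    show "\<forall>\<^sub>F T in at_top. (1 - \<eta>) * b T \<le> b (T - \<epsilon>)"
      using less_LiminfD[OF \<epsilon>(2)] pos by eventually_elim (simp add: divide_simps)
  qed
qed

text \<open>
  Choose \<open>\<eta>\<close> and \<open>\<delta>\<close> small compared with \<open>e\<close>, then \<open>\<epsilon>\<close> from regularity, and only then \<open>C\<close>; the
  constant \<open>C\<close> may depend on all of these because \<open>b\<close> tends to infinity.
\<close>
lemma asymp_equiv_of_regular_squeeze:
  fixes N b :: "real \<Rightarrow> real"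
  assumes reg: "regular_growth b" and "mono b" and "a > 0"
    and squeeze: "\<And>\<epsilon> \<delta>. \<epsilon> > 0 \<Longrightarrow> \<delta> > 0 \<Longrightarrow>
      \<exists>C. \<forall>T. N (T - \<epsilon>) \<le> (a + \<delta>) * b T + C \<and> (a - \<delta>) * b T - C \<le> N (T + \<epsilon>)"
  shows "N \<sim>[at_top] (\<lambda>T. a * b T)"
proof (rule asymp_equivI'_const)
  have lim: "filterlim b at_top at_top"
    using reg unfolding regular_growth_def by auto
  have pos: "eventually (\<lambda>T. b T > 0) at_top"
    using lim by (simp add: filterlim_at_top_dense)
  show "((\<lambda>T. N T / b T) \<longlongrightarrow> a) at_top"
  proof (rule tendstoI)
    fix e :: real assume "e > 0"
    \<comment> \<open>The errors \<open>\<delta>\<close>, \<open>\<eta> * a\<close> and \<open>\<delta> * \<eta>\<close> cost at most \<open>e / 4\<close> each, which leaves room for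
      \<open>C\<close>; \<open>\<delta> \<le> a\<close> keeps the lower factor nonnegative.\<close>
    define \<eta> where "\<eta> = min 1 (e / (4 * (a + 1)))"
    define \<delta> where "\<delta> = min a (e / 4)"
    have \<eta>: "0 < \<eta>" "\<eta> \<le> 1" and \<eta>a: "\<eta> * a \<le> e / 4"
    proof -
      have "\<eta> * (a + 1) \<le> e / (4 * (a + 1)) * (a + 1)"
        unfolding \<eta>_def using \<open>a > 0\<close> by (intro mult_right_mono) auto
      also have "\<dots> = e / 4" using \<open>a > 0\<close> by (simp add: field_simps)
      finally have 1: "\<eta> * (a + 1) \<le> e / 4" .
      show "0 < \<eta>" "\<eta> \<le> 1" using \<open>a > 0\<close> \<open>e > 0\<close> by (auto simp: \<eta>_def)
      then show "\<eta> * a \<le> e / 4" using 1 by (simp add: algebra_simps)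
    qed
    have \<delta>: "0 < \<delta>" "\<delta> \<le> a" "\<delta> \<le> e / 4"
      using \<open>a > 0\<close> \<open>e > 0\<close> by (auto simp: \<delta>_def)
    obtain \<epsilon> where \<epsilon>: "\<epsilon> > 0" and up: "eventually (\<lambda>T. b (T + \<epsilon>) \<le> (1 + \<eta>) * b T) at_top"
      and low: "eventually (\<lambda>T. (1 - \<eta>) * b T \<le> b (T - \<epsilon>)) at_top"
      using regular_growth_eventually[OF reg \<open>mono b\<close> \<eta>(1)] by blast
    obtain C where C: "\<And>T. N (T - \<epsilon>) \<le> (a + \<delta>) * b T + C"
        "\<And>T. (a - \<delta>) * b T - C \<le> N (T + \<epsilon>)"
      using squeeze[OF \<epsilon> \<delta>(1)] by blast
    have "eventually (\<lambda>T. b T > 8 * (\<bar>C\<bar> + 1) / e) at_top"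
      using lim by (simp add: filterlim_at_top_dense)
    then show "eventually (\<lambda>T. dist (N T / b T) a < e) at_top"
      using up low pos
    proof eventually_elim
      case (elim T)
      have big: "\<bar>C\<bar> < e / 8 * b T"
        using elim(1) \<open>e > 0\<close> by (simp add: field_simps)
      have "N T \<le> (a + \<delta>) * b (T + \<epsilon>) + C" using C(1)[of "T + \<epsilon>"] by simp
      also have "\<dots> \<le> (a + \<delta>) * ((1 + \<eta>) * b T) + C"
        using elim(2) \<open>a > 0\<close> \<delta> by (intro add_right_mono mult_left_mono) auto
      also have "\<dots> = (a + \<delta> + \<eta> * a + \<delta> * \<eta>) * b T + C" by (simp add: algebra_simps)
      also have "\<dots> \<le> (a + e / 4 + e / 4 + e / 4) * b T + C"
      proof -
        have "\<delta> * \<eta> \<le> e / 4 * 1" using \<delta> \<eta> \<open>e > 0\<close> by (intro mult_mono) auto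
        then show ?thesis
          using \<delta> \<eta>a elim(4) by (intro add_right_mono mult_right_mono) auto
      qed
      also have "\<dots> < (a + e) * b T"
        using big elim(4) by (simp add: algebra_simps)
      finally have 1: "N T < (a + e) * b T" .
      have "(a - e) * b T < (a - e / 4 - e / 4) * b T - C"
        using big elim(4) by (simp add: algebra_simps)
      also have "\<dots> \<le> (a - \<delta> - \<eta> * a + \<delta> * \<eta>) * b T - C"
      proof -
        have "\<delta> * \<eta> \<ge> 0" using \<delta> \<eta> by simp
        then show ?thesis
          using \<delta> \<eta>a elim(4) by (intro diff_right_mono mult_right_mono) auto
      qed
      also have "\<dots> = (a - \<delta>) * ((1 - \<eta>) * b T) - C" by (simp add: algebra_simps)
      also have "\<dots> \<le> (a - \<delta>) * b (T - \<epsilon>) - C"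
        using elim(3) \<delta> by (intro diff_right_mono mult_left_mono) auto
      also have "\<dots> \<le> N T" using C(2)[of "T - \<epsilon>"] by simp
      finally have 2: "(a - e) * b T < N T" .
      have "N T / b T < a + e" "a - e < N T / b T"
        using 1 2 elim(4) by (simp_all add: divide_simps)
      then show ?case by (simp add: dist_real_def abs_less_iff)
    qed
  qed
qed (use \<open>a > 0\<close> in simp)

theorem theorem1p4:
  fixes \<mu> :: "'g::{topological_group_add,t2_space} measure"
    and \<Gamma> K :: "'g set"
    and \<nu> :: "'g set measure"
    and d :: "'g set \<Rightarrow> 'g set \<Rightarrow> real"
  assumes "locally_compact_space (euclidean :: 'g topology)"
    and "haar_measure \<mu>"
    and "lattice_subgroup \<Gamma>"
    and "quotient_measure \<mu> \<Gamma> \<nu>"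
    and "is_subgroup K" and "compact K"
    and "invariant_proper_metric K d"
    and "acts_K_mixingly K \<nu>"
    and "regular_growth (ball_volume \<mu> K d)"
  shows "(\<lambda>T. real (lattice_count \<Gamma> K d T))
           \<sim>[at_top] (\<lambda>T. 1 / measure \<nu> (space \<nu>) * ball_volume \<mu> K d T)"
proof -
  define len where "len g = d (ltrans g K) (ltrans 0 K)" for g
  have "proper_length len"
    using proper_length_of_invariant_metric[OF assms(1,5,6,7)] unfolding len_def .
  then interpret lattice_with_length len \<mu> \<Gamma> \<nu>
    using assms by (simp add: lattice_with_length_def lattice_with_length_axioms_def)
  have count: "lattice_count \<Gamma> K d = (\<lambda>T. card {\<gamma>\<in>\<Gamma>. len \<gamma> \<le> T})"
    and vol: "ball_volume \<mu> K d = (\<lambda>T. measure \<mu> {x. len x \<le> T})"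
    by (simp_all add: fun_eq_iff lattice_count_def ball_volume_def len_def)
  have len_K: "len k = 0" if "k \<in> K" for k
    using len_zero ltrans_subgroup[OF assms(5) that] by (simp add: len_def)
  show ?thesis
  proof (rule asymp_equiv_of_regular_squeeze[OF assms(9)])
    show "mono (ball_volume \<mu> K d)"
    proof (rule monoI)
      fix S T :: real assume "S \<le> T"
      then show "ball_volume \<mu> K d S \<le> ball_volume \<mu> K d T"
        unfolding vol using ball_in_sets emeasure_ball_finite
        by (intro measure_mono_fmeasurable fmeasurableI) (auto simp: top.not_eq_extremum)
    qed
    show "1 / measure \<nu> (space \<nu>) > 0" using vol_pos by simp
    show "\<exists>C. \<forall>T. real (lattice_count \<Gamma> K d (T - \<epsilon>)) \<le> (1 / measure \<nu> (space \<nu>) + \<delta>) * ball_volume \<mu> K d T + C \<and>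
        (1 / measure \<nu> (space \<nu>) - \<delta>) * ball_volume \<mu> K d T - C \<le> real (lattice_count \<Gamma> K d (T + \<epsilon>))"
      if "\<epsilon> > 0" "\<delta> > 0" for \<epsilon> \<delta>
      unfolding count vol using assms(8) len_K that by (rule lattice_count_bounds)
  qed
qed

end
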